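(* If $\mathcal{F}$ is a family of $(B,\frac12)$-homothets of a centrally symmetric body $B$ in $\mathbb{R}^2$ and $\mathcal{F}$ satisfies the $(4,3)$ property, then $\tau(\mathcal{F})\le 4$.
   Context: For a centrally symmetric body $B\subset\mathbb{R}^2$ and a number $0<r\le 1$, a $(B,r)$-homothet is a set of the form $tB+u$ for some number $r\le t\le 1$ and a point $u\in\mathbb{R}^2$. A family $\mathcal{F}$ of sets satisfies the $(4,3)$ property if among any four members of $\mathcal{F}$ there exist three with a non-empty common intersection. The piercing number $\tau(\mathcal{F})$ is the minimum size of a set of points in $\mathbb{R}^2$ intersecting every set in $\mathcal{F}$. *)

theory Defs
  imports "HOL-Analysis.Analysis" "HOL-Library.Extended_Nat"
begin

text \<open>
  As usual in convex geometry, a body is a compact convex set with non-empty interior.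
\<close>

definition body :: "(real^2) set \<Rightarrow> bool" where
  "body B \<longleftrightarrow> compact B \<and> convex B \<and> interior B \<noteq> {}"

text \<open>
  The centre \<open>c\<close> of symmetry is not required to be the origin.
\<close>

definition centrally_symmetric :: "(real^2) set \<Rightarrow> bool" where
  "centrally_symmetric B \<longleftrightarrow> (\<exists>c. (\<lambda>x. 2 *\<^sub>R c - x) ` B = B)"

definition homothet :: "(real^2) set \<Rightarrow> real \<Rightarrow> (real^2) set \<Rightarrow> bool" where
  "homothet B r S \<longleftrightarrow> (\<exists>t u. r \<le> t \<and> t \<le> 1 \<and> S = (\<lambda>x. t *\<^sub>R x + u) ` B)"

definition pq_property :: "nat \<Rightarrow> nat \<Rightarrow> 'a set set \<Rightarrow> bool" where
  "pq_property p q F \<longleftrightarrow>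
     (\<forall>G\<subseteq>F. card G = p \<longrightarrow> (\<exists>H\<subseteq>G. card H = q \<and> \<Inter>H \<noteq> {}))"

text \<open>
  The piercing number is \<open>\<infinity>\<close> (the infimum of the empty set) when no finite set of points
  pierces the family; otherwise the infimum is an attained minimum.
\<close>

definition piercing_number :: "'a set set \<Rightarrow> enat" where
  "piercing_number F = (INF P \<in> {P. finite P \<and> (\<forall>S\<in>F. P \<inter> S \<noteq> {})}. enat (card P))"

end

theory Submission
  imports Defs
begin

text \<open>
  By a theorem of Asplund there are affine coordinates in which the body \<open>B\<close> lies between a centred
  square and \<open>3/2\<close> times that square, with the corners of the inner square on the boundary of \<open>B\<close>.
  Every homothet thus contains an inner square and is contained in an outer one, and the inner squares
  of two intersecting homothets cannot be separated in both coordinates at once.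

  By the \<open>(4,3)\<close> property some member \<open>L\<close> belongs to every disjoint pair, and of any three other members
  two of which miss \<open>L\<close>, all three have a common point. If the inner square of \<open>L\<close> is not too far from
  those of the other members, the corners of a square of side 2 in the middle pierce all inner squares.
  Otherwise three points suited to \<open>L\<close> are chosen in the inner squares in such a way that the sets that
  are missed satisfy the hypotheses of Helly's theorem and share a fourth point. Infinite families
  follow by compactness.
\<close>

section \<open>Families of boxes\<close>

text \<open>The ratio bound 1/2 and Asplund's constant 3/2 are matched: an inner interval stops at
  most 1 short of its outer interval and has length at least 2, so it cannot fit strictly between
  \<open>x - 1\<close> and \<open>x + 1\<close> when its outer interval contains \<open>x\<close>.
  For pairwise intersecting sets this is enough, as their outer squares share a point. The obstacle
  is \<open>L\<close>, which may miss any number of the others, so that its outer square can be far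
  from the common rectangle. Inner squares guarantee points of a set and outer squares only limit
  where it can be; when the two disagree, coordinates do not supply a fourth point. The three
  explicit points therefore have the purpose of forcing the missed sets into positions in which
  inner squares overlap in both coordinates, which for boxes already yields common points of
  triples.\<close>

definition pierced4 :: "'a set set \<Rightarrow> bool" where
  "pierced4 F \<longleftrightarrow> (\<exists>p1 p2 p3 p4. \<forall>W\<in>F. p1 \<in> W \<or> p2 \<in> W \<or> p3 \<in> W \<or> p4 \<in> W)"

lemma pierced4I:
  assumes "\<And>W. W \<in> F \<Longrightarrow> p1 \<in> W \<or> p2 \<in> W \<or> p3 \<in> W \<or> p4 \<in> W"
  shows "pierced4 F"
  using assms unfolding pierced4_def by blast

lemma pierced4_mono:
  assumes "pierced4 F" "F' \<subseteq> F"
  shows "pierced4 F'"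
proof -
  obtain a b c d where p: "\<forall>W\<in>F. a \<in> W \<or> b \<in> W \<or> c \<in> W \<or> d \<in> W"
    using assms(1) unfolding pierced4_def by (elim exE) (rule that)
  show ?thesis by (rule pierced4I) (rule p[rule_format, OF subsetD[OF assms(2)]])
qed

lemma helly_intervals:
  fixes b u :: "'i \<Rightarrow> real"
  assumes "finite S" "S \<noteq> {}" "\<And>i j. i \<in> S \<Longrightarrow> j \<in> S \<Longrightarrow> b i \<le> u j"
  obtains y where "\<And>i. i \<in> S \<Longrightarrow> b i \<le> y \<and> y \<le> u i"
proof
  fix i assume "i \<in> S"
  then show "b i \<le> Max (b ` S) \<and> Max (b ` S) \<le> u i"
    using assms by auto
qed

text \<open>
  \<open>W\<close> plays the role of a homothet with ratio \<open>s W\<close> whose centre has coordinates \<open>c1 W\<close>, \<open>c2 W\<close>: its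
  inner and outer squares have half-sides \<open>2 * s W\<close> and \<open>3 * s W\<close>. As the ratios lie in \<open>[1/2, 1]\<close>, inner
  squares have side at least 2 and stay within distance 1 of the outer square. The locale is stated
  axiomatically so that it is invariant under reflections and under exchanging the coordinates.
\<close>

locale box_family =
  fixes c1 c2 s :: "'a set \<Rightarrow> real" and pt :: "real \<Rightarrow> real \<Rightarrow> 'a"
    and N :: "'a set set" and L :: "'a set"
  assumes fin: "finite N" and ne: "N \<noteq> {}"
    and s_ge: "W \<in> insert L N \<Longrightarrow> 1/2 \<le> s W"
    and s_le: "W \<in> insert L N \<Longrightarrow> s W \<le> 1"
    and inner: "W \<in> insert L N \<Longrightarrow> \<bar>x - c1 W\<bar> \<le> 2 * s W \<Longrightarrow> \<bar>y - c2 W\<bar> \<le> 2 * s W \<Longrightarrow> pt x y \<in> W"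
    and outer1: "W \<in> insert L N \<Longrightarrow> V \<in> insert L N \<Longrightarrow> W \<inter> V \<noteq> {} \<Longrightarrow> \<bar>c1 W - c1 V\<bar> \<le> 3 * (s W + s V)"
    and outer2: "W \<in> insert L N \<Longrightarrow> V \<in> insert L N \<Longrightarrow> W \<inter> V \<noteq> {} \<Longrightarrow> \<bar>c2 W - c2 V\<bar> \<le> 3 * (s W + s V)"
    and diag: "W \<in> insert L N \<Longrightarrow> V \<in> insert L N \<Longrightarrow> W \<inter> V \<noteq> {} \<Longrightarrow>
       \<bar>c1 W - c1 V\<bar> \<le> 2 * (s W + s V) \<or> \<bar>c2 W - c2 V\<bar> \<le> 2 * (s W + s V)"
    and pairwise: "W \<in> N \<Longrightarrow> V \<in> N \<Longrightarrow> W \<inter> V \<noteq> {}"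
    and helly: "Q \<subseteq> N \<Longrightarrow> (\<And>W W' V. W \<in> Q \<Longrightarrow> W' \<in> Q \<Longrightarrow> V \<in> Q \<Longrightarrow> W \<inter> L \<noteq> {} \<Longrightarrow> W' \<inter> L \<noteq> {} \<Longrightarrow>
         W \<inter> W' \<inter> V \<noteq> {}) \<Longrightarrow> \<exists>p. \<forall>W\<in>Q. p \<in> W"
begin

text \<open>
  \<open>l\<close>, \<open>r\<close>, \<open>b\<close>, \<open>u\<close> are the left, right, lower and upper sides of the inner square; the
  rectangle \<open>{\<delta>..\<rho>} \<times> {\<gamma>..\<eta>}\<close> is the intersection of the outer squares of the members of \<open>N\<close>.
\<close>

definition "l W = c1 W - 2 * s W"
definition "r W = c1 W + 2 * s W"
definition "b W = c2 W - 2 * s W"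
definition "u W = c2 W + 2 * s W"
definition "\<delta> = Max ((\<lambda>W. c1 W - 3 * s W) ` N)"
definition "\<rho> = Min ((\<lambda>W. c1 W + 3 * s W) ` N)"
definition "\<gamma> = Max ((\<lambda>W. c2 W - 3 * s W) ` N)"
definition "\<eta> = Min ((\<lambda>W. c2 W + 3 * s W) ` N)"

lemma in_inner: "W \<in> insert L N \<Longrightarrow> l W \<le> x \<Longrightarrow> x \<le> r W \<Longrightarrow> b W \<le> y \<Longrightarrow> y \<le> u W \<Longrightarrow> pt x y \<in> W"
  by (rule inner) (auto simp: l_def r_def b_def u_def)

lemma range1: assumes "W \<in> N" shows "c1 W - 3 * s W \<le> \<delta>" "\<delta> \<le> c1 W + 3 * s W" "c1 W - 3 * s W \<le> \<rho>" "\<rho> \<le> c1 W + 3 * s W"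
proof -
  have *: "c1 V - 3 * s V \<le> c1 V' + 3 * s V'" if "V \<in> N" "V' \<in> N" for V V'
    using outer1[of V V'] pairwise[OF that] that by (auto simp: abs_le_iff algebra_simps)
  show "c1 W - 3 * s W \<le> \<delta>" "\<rho> \<le> c1 W + 3 * s W"
    unfolding \<delta>_def \<rho>_def using assms fin by (auto intro!: Max_ge Min_le)
  show "\<delta> \<le> c1 W + 3 * s W" "c1 W - 3 * s W \<le> \<rho>"
    unfolding \<delta>_def \<rho>_def using assms fin ne * by (auto intro!: Max.boundedI Min.boundedI)
qed

lemma range2: assumes "W \<in> N" shows "c2 W - 3 * s W \<le> \<gamma>" "\<gamma> \<le> c2 W + 3 * s W" "c2 W - 3 * s W \<le> \<eta>" "\<eta> \<le> c2 W + 3 * s W"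
proof -
  have *: "c2 V - 3 * s V \<le> c2 V' + 3 * s V'" if "V \<in> N" "V' \<in> N" for V V'
    using outer2[of V V'] pairwise[OF that] that by (auto simp: abs_le_iff algebra_simps)
  show "c2 W - 3 * s W \<le> \<gamma>" "\<eta> \<le> c2 W + 3 * s W"
    unfolding \<gamma>_def \<eta>_def using assms fin by (auto intro!: Max_ge Min_le)
  show "\<gamma> \<le> c2 W + 3 * s W" "c2 W - 3 * s W \<le> \<eta>"
    unfolding \<gamma>_def \<eta>_def using assms fin ne * by (auto intro!: Max.boundedI Min.boundedI)
qed

lemma ranges_nonempty: "\<delta> \<le> \<rho>" "\<gamma> \<le> \<eta>"
proof -
  show "\<delta> \<le> \<rho>" unfolding \<rho>_def using fin ne range1(2) by (auto intro!: Min.boundedI)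
  show "\<gamma> \<le> \<eta>" unfolding \<eta>_def using fin ne range2(2) by (auto intro!: Min.boundedI)
qed

lemmas ival = l_def r_def b_def u_def

text \<open>With \<open>1/2 \<le> s W \<le> 1\<close> the side \<open>4 * s W\<close> is at least 2,
  the margin \<open>s W\<close> at most 1, and the distance \<open>5 * s W\<close> from an outer
  side to the opposite inner side at least 5/2.\<close>

lemma widths:
  assumes "W \<in> insert L N"
  shows "l W + 2 \<le> r W" "b W + 2 \<le> u W"
    "l W \<le> c1 W - 3 * s W + 1" "c1 W + 3 * s W - 1 \<le> r W" "b W \<le> c2 W - 3 * s W + 1" "c2 W + 3 * s W - 1 \<le> u W"
    "c1 W - 3 * s W + 5/2 \<le> r W" "l W \<le> c1 W + 3 * s W - 5/2" "r W \<le> c1 W + 3 * s W" "u W \<le> c2 W + 3 * s W"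
    "c1 W - 3 * s W \<le> l W" "c2 W - 3 * s W \<le> b W"
  using s_ge[OF assms] s_le[OF assms] by (auto simp: ival)

lemma meetD:
  assumes "W \<in> insert L N" "V \<in> insert L N" "W \<inter> V \<noteq> {}"
  shows "(l W \<le> r V \<and> l V \<le> r W) \<or> (b W \<le> u V \<and> b V \<le> u W)"
  using diag[OF assms] by (auto simp: ival abs_le_iff algebra_simps)

lemma meet_outer:
  assumes "W \<in> insert L N" "V \<in> insert L N" "W \<inter> V \<noteq> {}"
  shows "c1 W - 3 * s W \<le> c1 V + 3 * s V" "c2 W - 3 * s W \<le> c2 V + 3 * s V"
  using outer1[OF assms] outer2[OF assms] by (auto simp: abs_le_iff algebra_simps)

text \<open>The inner interval starts by \<open>x + 1\<close> and does not end before
  \<open>x - 1\<close>. If it contained neither point, it would lie strictly between them and be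
  shorter than 2.\<close>

lemma columns:
  assumes "W \<in> N" "\<delta> \<le> x" "x \<le> \<rho>"
  shows "(l W \<le> x - 1 \<and> x - 1 \<le> r W) \<or> (l W \<le> x + 1 \<and> x + 1 \<le> r W)"
  using range1[OF assms(1)] widths[of W] assms by (auto simp: not_le)

lemma rows:
  assumes "W \<in> N" "\<gamma> \<le> y" "y \<le> \<eta>"
  shows "(b W \<le> y - 1 \<and> y - 1 \<le> u W) \<or> (b W \<le> y + 1 \<and> y + 1 \<le> u W)"
  using range2[OF assms(1)] widths[of W] assms by (auto simp: not_le)

lemma interval_choice:
  fixes a b' d e :: real
  assumes "d \<le> e" "a + 2 \<le> b'" "d - 1 \<le> b'" "a \<le> e + 1"
  obtains x where "d \<le> x" "x \<le> e" "(a \<le> x - 1 \<and> x - 1 \<le> b') \<or> (a \<le> x + 1 \<and> x + 1 \<le> b')"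
proof (cases "a \<le> e - 1")
  case True
  then show ?thesis using that[of "max d (a + 1)"] assms by (auto simp: max_def)
next
  case False
  then show ?thesis using that[of "max d (a - 1)"] assms by (auto simp: max_def split: if_splits)
qed

section \<open>\<open>L\<close> close to the common rectangle of the others\<close>

lemma four_corners:
  assumes "\<delta> - 1 \<le> r L" "l L \<le> \<rho> + 1" "\<gamma> - 1 \<le> u L" "b L \<le> \<eta> + 1"
  shows "pierced4 (insert L N)"
proof -
  obtain x where x: "\<delta> \<le> x" "x \<le> \<rho>" "(l L \<le> x - 1 \<and> x - 1 \<le> r L) \<or> (l L \<le> x + 1 \<and> x + 1 \<le> r L)"
    using interval_choice[OF ranges_nonempty(1) widths(1)[of L] assms(1,2)] by auto
  obtain y where y: "\<gamma> \<le> y" "y \<le> \<eta>" "(b L \<le> y - 1 \<and> y - 1 \<le> u L) \<or> (b L \<le> y + 1 \<and> y + 1 \<le> u L)"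
    using interval_choice[OF ranges_nonempty(2) widths(2)[of L] assms(3,4)] by auto
  show ?thesis
  proof (rule pierced4I[of _ "pt (x-1) (y-1)" "pt (x-1) (y+1)" "pt (x+1) (y-1)" "pt (x+1) (y+1)"])
    fix W assume W: "W \<in> insert L N"
    have "(l W \<le> x - 1 \<and> x - 1 \<le> r W) \<or> (l W \<le> x + 1 \<and> x + 1 \<le> r W)"
      using W x columns by auto
    moreover have "(b W \<le> y - 1 \<and> y - 1 \<le> u W) \<or> (b W \<le> y + 1 \<and> y + 1 \<le> u W)"
      using W y rows by auto
    ultimately show "pt (x-1) (y-1) \<in> W \<or> pt (x-1) (y+1) \<in> W \<or> pt (x+1) (y-1) \<in> W \<or> pt (x+1) (y+1) \<in> W"
      using in_inner[OF W] by blast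
  qed
qed

section \<open>\<open>L\<close> far to the left of the others\<close>

lemma common_inner:
  assumes "W \<in> insert L N" "W' \<in> insert L N" "V \<in> insert L N"
    "\<And>X Y. X \<in> {W,W',V} \<Longrightarrow> Y \<in> {W,W',V} \<Longrightarrow> l X \<le> r Y \<and> b X \<le> u Y"
  shows "W \<inter> W' \<inter> V \<noteq> {}"
proof -
  obtain x where x: "\<And>X. X \<in> {W,W',V} \<Longrightarrow> l X \<le> x \<and> x \<le> r X"
    using helly_intervals[of "{W,W',V}" l r] assms(4) by blast
  obtain y where y: "\<And>X. X \<in> {W,W',V} \<Longrightarrow> b X \<le> y \<and> y \<le> u X"
    using helly_intervals[of "{W,W',V}" b u] assms(4) by blast
  have "pt x y \<in> W" "pt x y \<in> W'" "pt x y \<in> V" using assms(1-3) x y in_inner by auto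
  then show ?thesis by blast
qed

text \<open>
  The inner squares left of the line \<open>x = m\<close> contain \<open>(r L, y)\<close>, those crossing it contain one of two
  points on it, and those right of it are left to Helly's theorem.
\<close>

lemma threshold_points:
  assumes left: "r L < \<delta> - 1" and m: "\<delta> - 1 \<le> m"
    and Lft: "\<And>Z Z'. Z \<in> N \<Longrightarrow> Z' \<in> N \<Longrightarrow> r Z < m \<Longrightarrow> r Z' < m \<Longrightarrow> b Z \<le> u Z'"
    and LL: "\<And>Z. Z \<in> N \<Longrightarrow> r Z < m \<Longrightarrow> r Z < c1 L + 3 * s L + 1 \<and> b L \<le> u Z \<and> b Z \<le> u L"
    and Rgt: "\<And>W W' V. W \<in> N \<Longrightarrow> W' \<in> N \<Longrightarrow> V \<in> N \<Longrightarrow> m < l W \<Longrightarrow> m < l W' \<Longrightarrow> m < l V \<Longrightarrow>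
       W \<inter> L \<noteq> {} \<Longrightarrow> W' \<inter> L \<noteq> {} \<Longrightarrow> W \<inter> W' \<inter> V \<noteq> {}"
  shows "pierced4 (insert L N)"
proof -
  let ?S = "insert L {Z\<in>N. r Z < m}"
  have "b i \<le> u j" if "i \<in> ?S" "j \<in> ?S" for i j
    using that Lft LL widths(2)[of L] by auto
  then obtain y where y: "\<And>i. i \<in> ?S \<Longrightarrow> b i \<le> y \<and> y \<le> u i"
    using helly_intervals[of ?S b u] fin by auto
  obtain p where p: "\<And>W. W \<in> N \<Longrightarrow> m < l W \<Longrightarrow> p \<in> W"
    using helly[of "{W\<in>N. m < l W}"] Rgt by (metis (mono_tags, lifting) mem_Collect_eq subsetI)
  show ?thesis
  proof (rule pierced4I[of _ "pt (r L) y" "pt m (\<eta>-1)" "pt m (\<eta>+1)" p])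
    fix W assume W: "W \<in> insert L N"
    consider "W = L" | "W \<in> N" "r W < m" | "W \<in> N" "m < l W" | "W \<in> N" "l W \<le> m" "m \<le> r W"
      using W by fastforce
    then show "pt (r L) y \<in> W \<or> pt m (\<eta> - 1) \<in> W \<or> pt m (\<eta> + 1) \<in> W \<or> p \<in> W"
    proof cases
      case 1 then show ?thesis using y[of L] widths(1)[of L] in_inner[of L] by auto
    next
      case 2
      \<comment> \<open>Ending before \<open>c1 L + 3 * s L + 1\<close>, the inner square starts
        before \<open>c1 L + 3 * s L - 1\<close>, hence left of \<open>r L\<close>; it extends
        beyond \<open>r L\<close> because it reaches \<open>\<delta> - 1\<close>.\<close>
      have "l W \<le> r L" using LL[OF 2] widths[of W] widths[of L] W by auto
      moreover have "r L \<le> r W" using left range1[OF 2(1)] widths[OF W] by auto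
      ultimately show ?thesis using y[of W] 2 in_inner[OF W] by auto
    next
      case 3 then show ?thesis using p by auto
    next
      case 4 then show ?thesis using rows[of W \<eta>] ranges_nonempty in_inner[OF W] by blast
    qed
  qed
qed

text \<open>
  Without an obstruction \<open>Z\<close>, \<open>threshold_points\<close> applies with the least \<open>m\<close> such that two inner squares
  ending left of or at \<open>m\<close> are vertically separated: each inner square right of \<open>m\<close> must overlap both of
  these vertically, so it covers the gap between them.
\<close>

lemma left_obstruction:
  assumes left: "r L < \<delta> - 1"
  shows "pierced4 (insert L N) \<or> (\<exists>Z\<in>N. r Z < c1 L + 3 * s L + 1 \<and> (u Z < b L \<or> u L < b Z))"
proof (rule ccontr)
  let ?lam = "c1 L + 3 * s L"
  assume "\<not> ?thesis"
  then have np: "\<not> pierced4 (insert L N)" and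
    comp: "\<And>Z. Z \<in> N \<Longrightarrow> r Z < ?lam + 1 \<Longrightarrow> b L \<le> u Z \<and> b Z \<le> u L" by (auto simp: not_less)
  let ?T = "{(Z,Z'). Z \<in> N \<and> Z' \<in> N \<and> r Z < ?lam + 1 \<and> r Z' < ?lam + 1 \<and> u Z < b Z'}"
  have finT: "finite ?T" using finite_subset[of ?T "N \<times> N"] fin by auto
  show False
  proof (cases "?T = {}")
    case True
    have "pierced4 (insert L N)"
    proof (rule threshold_points[OF left, of "max (?lam+1) (\<delta>-1)"])
      have *: "r Z < ?lam + 1" if "Z \<in> N" "r Z < max (?lam+1) (\<delta>-1)" for Z
        using that range1[OF that(1)] widths[of Z] by (auto simp: max_def split: if_splits)
      show "b Z \<le> u Z'" if "Z \<in> N" "Z' \<in> N" "r Z < max (?lam+1) (\<delta>-1)" "r Z' < max (?lam+1) (\<delta>-1)" for Z Z'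
        using True that * by (force simp: not_less)
      show "r Z < ?lam + 1 \<and> b L \<le> u Z \<and> b Z \<le> u L" if "Z \<in> N" "r Z < max (?lam+1) (\<delta>-1)" for Z
        using * comp that by auto
      \<comment> \<open>The outer squares of these sets start right of the outer square of
        \<open>L\<close>, so none of them meets \<open>L\<close> and the condition is
        vacuous.\<close>
      show "W \<inter> W' \<inter> V \<noteq> {}" if "W \<in> N" "max (?lam+1) (\<delta>-1) < l W" "W \<inter> L \<noteq> {}" for W W' V
        using that meet_outer(1)[of W L] widths[of W] by auto
    qed auto
    then show False using np by simp
  next
    case False
    define g where "g = (\<lambda>(Z,Z'). max (r Z) (r Z'))"
    obtain Z Z' where ZZ: "(Z,Z') \<in> ?T" and min: "\<And>P. P \<in> ?T \<Longrightarrow> g (Z,Z') \<le> g P"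
    proof -
      obtain P where "P \<in> ?T" "\<And>Q. Q \<in> ?T \<Longrightarrow> g P \<le> g Q"
        using obtains_MIN[OF finT False, of g] by (metis (no_types, lifting) Min_le finT finite_imageI imageI)
      then show ?thesis using that by (cases P) auto
    qed
    define m where "m = max (r Z) (r Z')"
    have Z: "Z \<in> N" "Z' \<in> N" "r Z < ?lam + 1" "r Z' < ?lam + 1" "u Z < b Z'" using ZZ by auto
    have m: "m < ?lam + 1" "r Z \<le> m" "r Z' \<le> m" using Z by (auto simp: m_def)
    have \<delta>m: "\<delta> - 1 \<le> m" using range1[OF Z(1)] widths[of Z] Z m by auto
    have "pierced4 (insert L N)"
    proof (rule threshold_points[OF left \<delta>m])
      show "b X \<le> u X'" if X: "X \<in> N" "X' \<in> N" "r X < m" "r X' < m" for X X'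
      proof (rule ccontr)
        assume "\<not> ?thesis"
        then have "(X',X) \<in> ?T" using X m by auto
        from min[OF this] show False using X by (auto simp: g_def m_def)
      qed
      show "r X < ?lam + 1 \<and> b L \<le> u X \<and> b X \<le> u L" if "X \<in> N" "r X < m" for X
        using m comp that by auto
      show "W \<inter> W' \<inter> V \<noteq> {}" if W: "W \<in> N" "W' \<in> N" "V \<in> N" "m < l W" "m < l W'" "m < l V" for W W' V
      proof (rule common_inner)
        fix X Y assume "X \<in> {W,W',V}" "Y \<in> {W,W',V}"
        then have X: "X \<in> N" "m < l X" and Y: "Y \<in> N" "m < l Y" using W by auto
        \<comment> \<open>\<open>l X\<close> is at most \<open>\<delta> + 1\<close>, and
          \<open>r Y\<close> exceeds \<open>m + 2\<close>, hence
          \<open>\<delta> + 1\<close>.\<close>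
        have 1: "l X \<le> r Y" using range1[OF X(1)] \<delta>m widths[of X] widths[of Y] X Y by auto
        have J: "b A \<le> u A' \<and> b A' \<le> u A" if "A \<in> {X,Y}" "A' \<in> {Z,Z'}" for A A'
          using meetD[of A A'] pairwise[of A A'] that X Y Z m by fastforce
        have "b X \<le> u Y"
          using J[of X Z] J[of X Z'] J[of Y Z] J[of Y Z'] Z(5) by auto
        then show "l X \<le> r Y \<and> b X \<le> u Y" using 1 by simp
      qed (use W in auto)
    qed
    then show False using np by simp
  qed
qed

text \<open>
  A set that meets \<open>L\<close> and avoids the first three points has its inner square in the quadrant
  \<open>x > \<delta> - 1\<close>, \<open>y < \<eta> + 1\<close>, hence contains \<open>(\<delta> + 1, \<eta> - 1)\<close>, and any other set avoiding the three
  points overlaps it in both coordinates.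
\<close>

lemma corner_points:
  assumes left: "r L < \<delta> - 1"
    and Z: "Z \<in> N" "r Z < c1 L + 3 * s L + 1" "u Z < b L"
    and above: "b L \<le> \<eta> + 1 \<or> (\<exists>A\<in>N. c2 L - 3 * s L - 1 < b A \<and> r L < l A)"
  shows "pierced4 (insert L N)"
proof -
  define \<mu> where "\<mu> = c1 L + 3 * s L"
  \<comment> \<open>\<open>h\<close> is a height reached by the outer square of every set meeting
    \<open>L\<close>, and \<open>k\<close> is the height of the point chosen on the right side of
    \<open>L\<close>. That \<open>k \<le> u L\<close> holds is due to \<open>Z\<close>, which lies
    below \<open>L\<close> and yet has its top at \<open>\<eta> - 1\<close> or higher.\<close>
  define h where "h = (if b L \<le> \<eta> + 1 then \<eta> else c2 L - 3 * s L)"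
  define k where "k = max (b L) (\<eta> + 1)"
  have wL: "l L + 2 \<le> r L" "b L + 2 \<le> u L" "\<mu> - 1 \<le> r L" "b L \<le> c2 L - 3 * s L + 1"
    using widths[of L] by (auto simp: \<mu>_def)
  have uZ: "\<eta> - 1 \<le> u Z" using range2[OF Z(1)] widths[of Z] Z by auto
  have kL: "b L \<le> k" "k \<le> u L" using wL uZ Z by (auto simp: k_def)
  have hk: "\<eta> \<le> h" "\<eta> + 1 \<le> k" "k \<le> h + 1" "b L \<le> k" using wL by (auto simp: h_def k_def)
  have \<mu>\<delta>: "\<mu> < \<delta>" using wL left by auto
  have base: "l W \<le> \<delta> + 1" "\<delta> - 1 \<le> r W" "b W \<le> \<eta> + 1" "\<eta> - 1 \<le> u W" "l W + 2 \<le> r W" "b W + 2 \<le> u W"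
    "c1 W - 3 * s W + 5/2 \<le> r W" "l W \<le> c1 W - 3 * s W + 1" "c2 W + 3 * s W - 1 \<le> u W" "u W \<le> c2 W + 3 * s W"
    if "W \<in> N" for W
    using range1[OF that] range2[OF that] widths[of W] that by auto
  \<comment> \<open>All that is used of a set meeting \<open>L\<close>: its outer square extends
    left as far as \<open>\<mu>\<close> and up as far as \<open>h\<close>. Sets missing
    \<open>L\<close> may have this property too.\<close>
  let ?good = "\<lambda>W. c1 W - 3 * s W \<le> \<mu> \<and> h \<le> c2 W + 3 * s W"
  have good: "?good W" if "W \<in> N" "W \<inter> L \<noteq> {}" for W
    using meet_outer[of W L] meet_outer[of L W] that range2[OF that(1)]
    by (auto simp: \<mu>_def h_def Int_commute)
  define Q where "Q = {W\<in>N. pt (r L) k \<notin> W \<and> pt (\<mu>+1) (\<eta>+1) \<notin> W \<and> pt (\<delta>-1) (h-1) \<notin> W}"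
  have Q1: "\<not> (l W \<le> r L \<and> r L \<le> r W \<and> b W \<le> k \<and> k \<le> u W)"
    and Q2: "\<not> (l W \<le> \<mu>+1 \<and> \<mu>+1 \<le> r W \<and> b W \<le> \<eta>+1 \<and> \<eta>+1 \<le> u W)"
    and Q3: "\<not> (l W \<le> \<delta>-1 \<and> \<delta>-1 \<le> r W \<and> b W \<le> h-1 \<and> h-1 \<le> u W)"
    if "W \<in> Q" for W using that in_inner[of W] by (auto simp: Q_def)
  have QN: "W \<in> N" if "W \<in> Q" for W using that by (auto simp: Q_def)
  have corner: "\<delta> - 1 < l W \<and> u W < \<eta> + 1" if "W \<in> Q" "?good W" for W
  proof -
    note bs = base[OF QN[OF that(1)]]
    have 1: "l W \<le> \<mu> + 1" "h - 1 \<le> u W" using bs that by auto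
    have 2: "r W < \<mu> + 1 \<or> u W < \<eta> + 1" using Q2[OF that(1)] 1 bs by auto
    have 3: "\<delta> - 1 < l W \<or> h - 1 < b W" using Q3[OF that(1)] 1 bs by auto
    \<comment> \<open>Otherwise \<open>W\<close> would span \<open>r L\<close> horizontally and
      \<open>k\<close> vertically and contain the first point.\<close>
    have 4: "\<not> (r W < \<mu> + 1 \<and> h - 1 < b W)"
      using Q1[OF that(1)] bs wL left hk by auto
    show ?thesis using 2 3 4 bs hk \<mu>\<delta> by auto
  qed
  have "\<exists>p. \<forall>W\<in>Q. p \<in> W"
  proof (rule helly)
    show "Q \<subseteq> N" using QN by auto
    fix W W' V assume W: "W \<in> Q" "W \<inter> L \<noteq> {}" and W': "W' \<in> Q" "W' \<inter> L \<noteq> {}" and V: "V \<in> Q"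
    have in_corner: "l X \<le> \<delta> + 1 \<and> \<delta> + 1 \<le> r X \<and> b X \<le> \<eta> - 1 \<and> \<eta> - 1 \<le> u X" if "X \<in> Q" "?good X" for X
      using corner[OF that] base[OF QN[OF that(1)]] by auto
    have meets: "l X \<le> r V \<and> l V \<le> r X \<and> b X \<le> u V \<and> b V \<le> u X" if X: "X \<in> Q" "X \<inter> L \<noteq> {}" for X
    proof (cases "?good V")
      case True then show ?thesis using in_corner[OF V] in_corner[OF X(1)] good[OF QN[OF X(1)] X(2)] by auto
    next
      case bad: False
      note gX = good[OF QN[OF X(1)] X(2)]
      note cX = corner[OF X(1) gX]
      note bX = base[OF QN[OF X(1)]] and bV = base[OF QN[OF V]]
      have XL: "(l X \<le> r L \<and> l L \<le> r X) \<or> (b X \<le> u L \<and> b L \<le> u X)"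
        using meetD[of X L] X QN by auto
      have ZV: "(l Z \<le> r V \<and> l V \<le> r Z) \<or> (b Z \<le> u V \<and> b V \<le> u Z)"
        using meetD[of Z V] pairwise[of Z V] Z(1) QN[OF V] by auto
      \<comment> \<open>If \<open>V\<close> were above \<open>X\<close>, it would reach above
        \<open>h + 1\<close>; failing \<open>?good\<close> and avoiding the second point, it would
        lie right of \<open>Z\<close>. Then \<open>Z\<close> forces the bottom of \<open>V\<close>
        below \<open>b L\<close>, whereas \<open>X\<close>, being right of \<open>L\<close>, must
        rise to \<open>b L\<close>.\<close>
      have 1: "b V \<le> u X"
      proof (rule ccontr)
        assume "\<not> ?thesis"
        then have a: "u X < b V" by simp
        have "h + 1 < u V" using a bX bV gX by linarith
        then have "\<mu> < c1 V - 3 * s V" using bad bV by linarith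
        moreover have "\<eta> + 1 \<le> u V" using \<open>h + 1 < u V\<close> hk by linarith
        ultimately have "\<mu> + 1 < l V" using Q2[OF V] bV by auto
        then have "b V \<le> u Z" using ZV Z(2) by (auto simp: \<mu>_def)
        moreover have "b L \<le> u X" using XL cX left by auto
        ultimately show False using a Z by linarith
      qed
      \<comment> \<open>The same argument with the axes exchanged and \<open>A\<close> in place of
        \<open>Z\<close>. If \<open>V\<close> were left of \<open>X\<close>, it could fail
        \<open>?good\<close> only by staying below \<open>h\<close>, which requires \<open>L\<close>
        to be far above. Avoiding the third point, \<open>V\<close> is below \<open>A\<close> and so
        must reach right of \<open>r L\<close>, whereas \<open>X\<close>, being below
        \<open>L\<close>, must start by \<open>r L\<close>.\<close>
      have 2: "l X \<le> r V"
      proof (rule ccontr)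
        assume "\<not> ?thesis"
        then have a: "r V < l X" by simp
        have rV: "r V < \<mu> + 1" using a bX gX by linarith
        then have "c2 V + 3 * s V < h" using bad bV by linarith
        moreover have "\<eta> \<le> c2 V + 3 * s V" using range2[OF QN[OF V]] by auto
        ultimately have far: "\<not> b L \<le> \<eta> + 1" "h = c2 L - 3 * s L" by (auto simp: h_def split: if_splits)
        then obtain A where A: "A \<in> N" "h - 1 < b A" "r L < l A" using above by auto
        have lV: "l V \<le> \<delta> - 1" using bV wL left rV by linarith
        have "b V \<le> h - 1" using bV \<open>c2 V + 3 * s V < h\<close> by linarith
        then have "u V < h - 1" using Q3[OF V] lV bV by auto
        then have "u V < b A" using A by linarith
        then have "l A \<le> r V" using meetD[of A V] pairwise[of A V] A QN[OF V] by auto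
        moreover have "l X \<le> r L" using XL cX far by auto
        ultimately show False using a A by linarith
      qed
      have "l V \<le> r X" using bV bX cX by linarith
      moreover have "b X \<le> u V" using cX bX bV by linarith
      ultimately show ?thesis using 1 2 by simp
    qed
    have WW: "l X \<le> r Y \<and> b X \<le> u Y" if "X \<in> Q" "X \<inter> L \<noteq> {}" "Y \<in> Q" "Y \<inter> L \<noteq> {}" for X Y
      using in_corner[OF that(1) good[OF QN[OF that(1)] that(2)]]
        in_corner[OF that(3) good[OF QN[OF that(3)] that(4)]] by linarith
    have VV: "l V \<le> r V \<and> b V \<le> u V" using base[OF QN[OF V]] by linarith
    show "W \<inter> W' \<inter> V \<noteq> {}"
    proof (rule common_inner)
      fix X Y assume "X \<in> {W,W',V}" "Y \<in> {W,W',V}"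
      then consider "X \<in> {W,W'}" "Y \<in> {W,W'}" | "X = V" "Y \<in> {W,W'}" | "X \<in> {W,W'}" "Y = V" | "X = V" "Y = V"
        by blast
      then show "l X \<le> r Y \<and> b X \<le> u Y"
      proof cases
        case 1 then show ?thesis using WW W W' by blast
      next
        case 2 then show ?thesis using meets W W' by blast
      next
        case 3 then show ?thesis using meets W W' by blast
      next
        case 4 then show ?thesis using VV by simp
      qed
    qed (use QN W W' V in auto)
  qed
  then obtain p where "\<And>W. W \<in> Q \<Longrightarrow> p \<in> W" by blast
  moreover have "pt (r L) k \<in> L" using in_inner[of L] wL kL by auto
  ultimately show ?thesis
    by (intro pierced4I[of _ "pt (r L) k" "pt (\<mu>+1) (\<eta>+1)" "pt (\<delta>-1) (h-1)" p]) (auto simp: Q_def)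
qed

end

section \<open>Reflections, and \<open>L\<close> far on any side\<close>

lemma (in box_family) flip1: "box_family (\<lambda>W. - c1 W) c2 s (\<lambda>x y. pt (- x) y) N L"
proof (unfold_locales, goal_cases)
  case (5 W x y) then show ?case using inner[of W "-x" y] by (simp add: abs_minus_commute algebra_simps)
next
  case (6 W V) then show ?case using outer1[of W V] by (simp add: abs_minus_commute)
next
  case (8 W V) then show ?case using diag[of W V] by (simp add: abs_minus_commute)
next
  case (7 W V) then show ?case using outer2 by simp
next
  case (9 W V) then show ?case using pairwise by simp
next
  case (10 Q) then show ?case by (intro helly)
qed (use fin ne s_ge s_le in auto)

lemma (in box_family) swap: "box_family c2 c1 s (\<lambda>x y. pt y x) N L"
proof (unfold_locales, goal_cases)
  case (5 W x y) then show ?case using inner[of W y x] by simp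
next
  case (6 W V) then show ?case using outer2 by simp
next
  case (7 W V) then show ?case using outer1 by simp
next
  case (8 W V) then show ?case using diag[of W V] by auto
next
  case (9 W V) then show ?case using pairwise by simp
next
  case (10 Q) then show ?case by (intro helly)
qed (use fin ne s_ge s_le in auto)

lemma (in box_family) flip2: "box_family c1 (\<lambda>W. - c2 W) s (\<lambda>x y. pt x (- y)) N L"
proof -
  interpret T: box_family c2 c1 s "\<lambda>x y. pt y x" N L by (rule swap)
  interpret U: box_family "\<lambda>W. - c2 W" c1 s "\<lambda>x y. pt y (- x)" N L by (rule T.flip1)
  show ?thesis by (rule U.swap)
qed

lemma Max_minus_image:
  fixes f :: "'i \<Rightarrow> real"
  assumes "finite S" "S \<noteq> {}"
  shows "Max ((\<lambda>i. - f i) ` S) = - Min (f ` S)"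
  using minus_Min_eq_Max[of "f ` S"] assms by (simp add: image_image)

text \<open>When \<open>L\<close> is also far above the others, the witness \<open>A\<close>
  required by \<open>corner_points\<close> is an obstruction as in \<open>left_obstruction\<close>,
  seen after reflection in the antidiagonal, which turns above into left.\<close>

lemma (in box_family) left_upper:
  assumes left: "r L < \<delta> - 1"
    and Z: "Z \<in> N" "r Z < c1 L + 3 * s L + 1" "u Z < b L"
  shows "pierced4 (insert L N)"
proof (cases "b L \<le> \<eta> + 1")
  case True
  then show ?thesis using corner_points[OF left Z] by simp
next
  case False
  interpret T: box_family c2 c1 s "\<lambda>x y. pt y x" N L by (rule swap)
  interpret U: box_family "\<lambda>W. - c2 W" c1 s "\<lambda>x y. pt y (- x)" N L by (rule T.flip1)
  interpret V: box_family "\<lambda>W. - c2 W" "\<lambda>W. - c1 W" s "\<lambda>x y. pt (- y) (- x)" N L by (rule U.flip2)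
  have "V.\<delta> = - \<eta>"
    using Max_minus_image[OF fin ne, of "\<lambda>W. c2 W + 3 * s W"] by (simp add: V.\<delta>_def \<eta>_def)
  then have "V.r L < V.\<delta> - 1" using False by (simp add: V.r_def b_def)
  from V.left_obstruction[OF this] show ?thesis
  proof
    assume "\<exists>A\<in>N. V.r A < - c2 L + 3 * s L + 1 \<and> (V.u A < V.b L \<or> V.u L < V.b A)"
    then obtain A where A: "A \<in> N" "c2 L - 3 * s L - 1 < b A" "r L < l A \<or> r A < l L"
      by (auto simp: V.ival ival)
    \<comment> \<open>An obstruction on the other side of \<open>L\<close> is impossible: every
      inner square of \<open>N\<close> reaches \<open>\<delta> - 1\<close>, which is right of
      \<open>L\<close>.\<close>
    have "\<delta> - 1 \<le> r A" using range1[OF A(1)] widths[of A] A by auto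
    then have "r L < l A" using A left widths(1)[of L] by auto
    then show ?thesis using corner_points[OF left Z] A by auto
  qed
qed

lemma (in box_family) left_far:
  assumes left: "r L < \<delta> - 1"
  shows "pierced4 (insert L N)"
  using left_obstruction[OF left]
proof
  assume "\<exists>Z\<in>N. r Z < c1 L + 3 * s L + 1 \<and> (u Z < b L \<or> u L < b Z)"
  then obtain Z where Z: "Z \<in> N" "r Z < c1 L + 3 * s L + 1" "u Z < b L \<or> u L < b Z" by blast
  interpret F: box_family c1 "\<lambda>W. - c2 W" s "\<lambda>x y. pt x (- y)" N L by (rule flip2)
  show ?thesis
  proof (cases "u Z < b L")
    case True then show ?thesis using left_upper[OF left] Z by blast
  next
    case False
    then have "F.u Z < F.b L" "F.r Z < c1 L + 3 * s L + 1" "F.r L < F.\<delta> - 1"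
      using Z left by (auto simp: F.ival ival F.\<delta>_def \<delta>_def)
    then show ?thesis using F.left_upper Z by blast
  qed
qed

lemma (in box_family) side_far:
  assumes "r L < \<delta> - 1 \<or> \<rho> + 1 < l L"
  shows "pierced4 (insert L N)"
proof (cases "r L < \<delta> - 1")
  case False
  interpret F: box_family "\<lambda>W. - c1 W" c2 s "\<lambda>x y. pt (- x) y" N L by (rule flip1)
  have "F.\<delta> = - \<rho>"
    using Max_minus_image[OF fin ne, of "\<lambda>W. c1 W + 3 * s W"] by (simp add: F.\<delta>_def \<rho>_def)
  then have "F.r L < F.\<delta> - 1" using False assms by (auto simp: F.ival ival)
  then show ?thesis by (rule F.left_far)
qed (rule left_far)

theorem (in box_family) pierced4: "pierced4 (insert L N)"
proof -
  interpret T: box_family c2 c1 s "\<lambda>x y. pt y x" N L by (rule swap)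
  have T: "T.r L = u L" "T.l L = b L" "T.\<delta> = \<gamma>" "T.\<rho> = \<eta>"
    by (auto simp: T.ival ival T.\<delta>_def \<gamma>_def T.\<rho>_def \<eta>_def)
  consider "r L < \<delta> - 1 \<or> \<rho> + 1 < l L" | "u L < \<gamma> - 1 \<or> \<eta> + 1 < b L"
    | "\<delta> - 1 \<le> r L" "l L \<le> \<rho> + 1" "\<gamma> - 1 \<le> u L" "b L \<le> \<eta> + 1" by linarith
  then show ?thesis
    using side_far T.side_far[unfolded T] four_corners by cases auto
qed

section \<open>Asplund's theorem\<close>

text \<open>
  The inequalities say that \<open>K\<close> lies in \<open>3/2\<close> times the parallelogram with vertices \<open>\<plusminus>p\<close> and \<open>\<plusminus>q\<close>.
\<close>

definition snug_pair :: "(real \<times> real) set \<Rightarrow> bool" where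
  "snug_pair K \<longleftrightarrow> (\<exists>p1 p2 q1 q2. (p1,p2) \<in> K \<and> (q1,q2) \<in> K \<and> 0 < p1 * q2 - p2 * q1 \<and>
     (\<forall>x y. (x,y) \<in> K \<longrightarrow> x * (q2 - p2) - y * (q1 - p1) \<le> 3/2 * (p1 * q2 - p2 * q1) \<and>
        x * (q2 + p2) - y * (q1 + p1) \<le> 3/2 * (p1 * q2 - p2 * q1)))"

text \<open>\<open>K\<close> in the coordinates of an inscribed centred parallelogram of largest
  area, whose vertices become the unit vectors and their negatives (an Auerbach basis). Maximality
  is \<open>det_le\<close>.\<close>

locale auerbach =
  fixes K :: "(real \<times> real) set"
  assumes compact: "compact K" and convex: "convex K"
    and sym: "(x,y) \<in> K \<Longrightarrow> (-x,-y) \<in> K"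
    and e1: "(1,0) \<in> K" and e2: "(0,1) \<in> K"
    and det_le: "(x,y) \<in> K \<Longrightarrow> (x',y') \<in> K \<Longrightarrow> x * y' - y * x' \<le> 1"
begin

lemma le1: assumes "(x,y) \<in> K" shows "x \<le> 1" "y \<le> 1" "-1 \<le> x" "-1 \<le> y"
  using det_le[OF assms e2] det_le[OF e1 assms] det_le[OF sym[OF assms] e2] det_le[OF e1 sym[OF assms]] by auto

lemma segment: assumes "(a,b) \<in> K" "(c,d) \<in> K" "0 \<le> t" "t \<le> 1"
  shows "(a + t * (c - a), b + t * (d - b)) \<in> K"
proof -
  have "(1 - t) *\<^sub>R (a,b) + t *\<^sub>R (c,d) \<in> K"
    using convexD_alt[OF convex assms] .
  then show ?thesis by (simp add: algebra_simps)
qed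

text \<open>
  The functional \<open>f\<close> supports \<open>K\<close> at \<open>w\<close>. The parallelogram has vertices \<open>2/3 * (w \<plusminus> v)\<close> with \<open>v = (f2, - f1)\<close>
  in the kernel of \<open>f\<close>; the conditions \<open>g\<close> say that the segments from \<open>w\<close> to \<open>(1,0)\<close> and to \<open>(0,1)\<close> reach
  far enough on the line \<open>f = 2/3\<close>.
\<close>

lemma snug_if_support:
  assumes w: "(w1,w2) \<in> K" and supp: "\<And>x y. (x,y) \<in> K \<Longrightarrow> f1 * x + f2 * y \<le> 1"
    and tight: "f1 * w1 + f2 * w2 = 1" and f: "f1 \<le> 2/3" "f2 \<le> 2/3"
    and g: "2 * (1 - f1) \<le> w2" "2 * (1 - f2) \<le> w1"
  shows "snug_pair K"
proof -
  \<comment> \<open>The parameters at which the two segments cross the line \<open>f = 2/3\<close>.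
    They do so at offsets \<open>t * w2\<close> along \<open>v\<close> and \<open>t' * w1\<close>
    along \<open>-v\<close> from \<open>2/3 * w\<close>, and \<open>g\<close> says that both offsets
    are at least 2/3.\<close>
  define t t' where "t = 1 / (3 * (1 - f1))" and "t' = 1 / (3 * (1 - f2))"
  have t: "0 \<le> t" "t \<le> 1" "t * (1 - f1) = 1/3" "2/3 \<le> t * w2"
    using f g by (auto simp: t_def field_simps)
  have t': "0 \<le> t'" "t' \<le> 1" "t' * (1 - f2) = 1/3" "2/3 \<le> t' * w1"
    using f g by (auto simp: t'_def field_simps)
  define a b where "a = t * w2" and "b = t' * w1"
  have ab: "2/3 \<le> a" "2/3 \<le> b" using t t' by (auto simp: a_def b_def)
  have p: "(w1 + t * (1 - w1), w2 + t * (0 - w2)) \<in> K" by (rule segment[OF w e1 t(1,2)])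
  have q: "(w1 + t' * (0 - w1), w2 + t' * (1 - w2)) \<in> K" by (rule segment[OF w e2 t'(1,2)])
  have solve: "x = 2/3 * w1 + f2 * Y \<and> y = 2/3 * w2 - f1 * Y"
    if "f1 * x + f2 * y = 2/3" "w2 * x - w1 * y = Y" for x y Y
  proof
    have "x = (f1 * w1 + f2 * w2) * x" using tight by simp
    also have "\<dots> = w1 * (f1 * x + f2 * y) + f2 * (w2 * x - w1 * y)" by (simp add: algebra_simps)
    finally show "x = 2/3 * w1 + f2 * Y" using that by simp
    have "y = (f1 * w1 + f2 * w2) * y" using tight by simp
    also have "\<dots> = w2 * (f1 * x + f2 * y) - f1 * (w2 * x - w1 * y)" by (simp add: algebra_simps)
    finally show "y = 2/3 * w2 - f1 * Y" using that by simp
  qed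
  have P: "(2/3 * w1 + f2 * a, 2/3 * w2 - f1 * a) \<in> K"
  proof -
    have "f1 * (w1 + t * (1 - w1)) + f2 * (w2 + t * (0 - w2)) = (f1 * w1 + f2 * w2) * (1 - t) + t * f1"
      by (simp add: algebra_simps)
    then have "f1 * (w1 + t * (1 - w1)) + f2 * (w2 + t * (0 - w2)) = 2/3"
      using tight t(3) by (simp add: algebra_simps)
    moreover have "w2 * (w1 + t * (1 - w1)) - w1 * (w2 + t * (0 - w2)) = a"
      by (simp add: a_def algebra_simps)
    ultimately show ?thesis using p solve by metis
  qed
  have Q: "(2/3 * w1 - f2 * b, 2/3 * w2 + f1 * b) \<in> K"
  proof -
    have "f1 * (w1 + t' * (0 - w1)) + f2 * (w2 + t' * (1 - w2)) = (f1 * w1 + f2 * w2) * (1 - t') + t' * f2"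
      by (simp add: algebra_simps)
    then have "f1 * (w1 + t' * (0 - w1)) + f2 * (w2 + t' * (1 - w2)) = 2/3"
      using tight t'(3) by (simp add: algebra_simps)
    moreover have "w2 * (w1 + t' * (0 - w1)) - w1 * (w2 + t' * (1 - w2)) = - b"
      by (simp add: b_def algebra_simps)
    ultimately show ?thesis using q solve by (metis add_uminus_conv_diff diff_minus_eq_add mult_minus_right)
  qed
  have between: "(2/3 * w1 + f2 * c, 2/3 * w2 - f1 * c) \<in> K" if "- b \<le> c" "c \<le> a" for c
  proof -
    define \<tau> where "\<tau> = (a - c) / (a + b)"
    have \<tau>: "0 \<le> \<tau>" "\<tau> \<le> 1" "\<tau> * (a + b) = a - c" using ab that by (auto simp: \<tau>_def field_simps)
    have d: "a - \<tau> * (a + b) = c" using \<tau>(3) by simp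
    have "(2/3 * w1 + f2 * a) + \<tau> * ((2/3 * w1 - f2 * b) - (2/3 * w1 + f2 * a)) = 2/3 * w1 + f2 * (a - \<tau> * (a + b))"
      "(2/3 * w2 - f1 * a) + \<tau> * ((2/3 * w2 + f1 * b) - (2/3 * w2 - f1 * a)) = 2/3 * w2 - f1 * (a - \<tau> * (a + b))"
      by (simp_all add: algebra_simps)
    then show ?thesis using segment[OF P Q \<tau>(1,2)] unfolding d by (simp only:)
  qed
  have in1: "(2/3 * w1 + f2 * (2/3), 2/3 * w2 - f1 * (2/3)) \<in> K" by (rule between) (use ab in auto)
  have in2: "(2/3 * w1 + f2 * (-2/3), 2/3 * w2 - f1 * (-2/3)) \<in> K" by (rule between) (use ab in auto)
  have D: "(2/3 * w1 + f2 * (2/3)) * (2/3 * w2 - f1 * (-2/3)) - (2/3 * w2 - f1 * (2/3)) * (2/3 * w1 + f2 * (-2/3)) = 8/9"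
    using tight by (simp add: algebra_simps)
  \<comment> \<open>One pair of sides is parallel to the support line, the other to
    \<open>w\<close>: up to the factor 4/3 the two inequalities are \<open>supp\<close> and
    \<open>det_le\<close> at \<open>w\<close>.\<close>
  have n1: "x * ((2/3 * w2 - f1 * (-2/3)) - (2/3 * w2 - f1 * (2/3))) - y * ((2/3 * w1 + f2 * (-2/3)) - (2/3 * w1 + f2 * (2/3))) \<le> 3/2 * (8/9)"
    if "(x,y) \<in> K" for x y
    using supp[OF that] by (simp add: algebra_simps)
  have n2: "x * ((2/3 * w2 - f1 * (-2/3)) + (2/3 * w2 - f1 * (2/3))) - y * ((2/3 * w1 + f2 * (-2/3)) + (2/3 * w1 + f2 * (2/3))) \<le> 3/2 * (8/9)"
    if "(x,y) \<in> K" for x y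
    using det_le[OF that w] by (simp add: algebra_simps)
  show ?thesis
    unfolding snug_pair_def
    by (rule exI[of _ "2/3 * w1 + f2 * (2/3)"], rule exI[of _ "2/3 * w2 - f1 * (2/3)"],
        rule exI[of _ "2/3 * w1 + f2 * (-2/3)"], rule exI[of _ "2/3 * w2 - f1 * (-2/3)"], unfold D)
      (intro conjI allI impI in1 in2 n1 n2, simp_all)
qed

text \<open>The parallelogram has vertices \<open>p\<close>, \<open>(0,1)\<close> and their
  negatives. Its side from \<open>p\<close> to \<open>(0,1)\<close> is parallel to the tangent
  \<open>a * x + y = 3/2\<close>, at 2/3 of the distance. The other inequality comes from
  \<open>det_le\<close> at the touching point \<open>(W,V)\<close>; the condition on
  \<open>p1\<close> is what is needed there in the worst case \<open>x = 1\<close>.\<close>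

lemma snug_if_low:
  assumes p: "(p1,p2) \<in> K" "0 < p1" "a * p1 + p2 = 1" "4 * W \<le> p1 * (3 * W + 1)"
    and supp: "\<And>x y. (x,y) \<in> K \<Longrightarrow> a * x + y \<le> 3/2"
    and w: "(W,V) \<in> K" "a * W + V = 3/2" "2/3 \<le> W" and a: "a \<le> 1"
  shows "snug_pair K"
proof -
  have second: "x * (1 + p2) - y * p1 \<le> 3/2 * p1" if u: "(x,y) \<in> K" for x y
  proof -
    have p1: "p1 \<le> 1" using le1[OF p(1)] by simp
    have 1: "1 + p2 = 2 - a * p1" using p(3) by linarith
    have "a * p1 \<le> 1 * p1" using a p(2) by (intro mult_right_mono) auto
    then have pos: "0 \<le> 1 + p2" using 1 p1 by linarith
    show ?thesis
    proof (cases "x \<le> 0")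
      case True
      then have "x * (1 + p2) \<le> 0" using pos by (simp add: mult_nonpos_nonneg)
      moreover have "- y * p1 \<le> 1 * p1" using le1[OF u] p(2) by (intro mult_right_mono) auto
      ultimately show ?thesis using p(2) by simp
    next
      case False
      have d: "x * V - y * W \<le> 1" using det_le[OF u w(1)] .
      have Wp: "0 < W" using w by simp
      have "W * (x * (1 + p2) - y * p1) = x * (2 * W - p1 * (a * W)) - p1 * (y * W)"
        by (simp add: 1 algebra_simps)
      also have "\<dots> \<le> x * (2 * W - p1 * (a * W)) + p1 * (1 - x * V)"
        using mult_left_mono[OF d, of p1] p(2) by (simp add: algebra_simps)
      also have "\<dots> = x * (2 * W - 3/2 * p1) + p1"
      proof -
        have V: "V = 3/2 - a * W" using w by simp
        show ?thesis unfolding V by (simp add: algebra_simps)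
      qed
      also have "\<dots> \<le> x * (p1 * (3/2 * W - 1)) + p1"
      proof -
        have "2 * W - 3/2 * p1 \<le> p1 * (3/2 * W - 1)" using p(4) by (simp add: algebra_simps)
        then show ?thesis using False by (intro add_mono mult_left_mono) auto
      qed
      also have "\<dots> \<le> 1 * (p1 * (3/2 * W - 1)) + p1"
        using le1[OF u] p(2) w(3) by (intro add_mono mult_right_mono) auto
      also have "\<dots> = W * (3/2 * p1)" by (simp add: algebra_simps)
      finally show ?thesis using Wp by simp
    qed
  qed
  have first: "x * (1 - p2) - y * (0 - p1) \<le> 3/2 * p1" if u: "(x,y) \<in> K" for x y
  proof -
    have 1: "1 - p2 = a * p1" using p(3) by linarith
    have "x * (1 - p2) - y * (0 - p1) = p1 * (a * x + y)" unfolding 1 by (simp add: algebra_simps)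
    then show ?thesis using mult_left_mono[OF supp[OF u], of p1] p(2) by simp
  qed
  show ?thesis unfolding snug_pair_def
    apply (rule exI[of _ p1], rule exI[of _ p2], rule exI[of _ 0], rule exI[of _ 1])
    using p e2 first second by auto
qed

text \<open>The tangent to \<open>K\<close> from the point \<open>(0, 3/2)\<close>, touching at \<open>(W, V)\<close>.\<close>

lemma extreme_slope:
  assumes "(x0,y0) \<in> K" "3/2 < x0 + y0"
  obtains a W V where "1/2 \<le> a" "a < 1" "(W,V) \<in> K" "a * W + V = 3/2"
    "\<And>x y. (x,y) \<in> K \<Longrightarrow> a * x + y \<le> 3/2"
proof -
  \<comment> \<open>The slope \<open>a\<close> is minimised over \<open>1/2 \<le> x\<close> only, to
    keep the denominator away from 0. Points further left satisfy the inequality anyway, since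
    \<open>a < 1\<close> and \<open>y \<le> 1\<close>.\<close>
  define S where "S = K \<inter> {z. 1/2 \<le> fst z}"
  have "compact S" unfolding S_def
    by (intro compact_Int_closed compact closed_Collect_le continuous_intros)
  moreover have "(x0,y0) \<in> S" using assms le1[OF assms(1)] by (auto simp: S_def)
  moreover have "continuous_on S (\<lambda>z. (3/2 - snd z) / fst z)"
    by (intro continuous_intros) (auto simp: S_def)
  ultimately obtain w where w: "w \<in> S" "\<And>z. z \<in> S \<Longrightarrow> (3/2 - snd w) / fst w \<le> (3/2 - snd z) / fst z"
    using continuous_attains_inf[of S "\<lambda>z. (3/2 - snd z) / fst z"] by blast
  obtain W V where WV: "w = (W,V)" by (cases w)
  define a where "a = (3/2 - V) / W"
  have K: "(W,V) \<in> K" "1/2 \<le> W" using w(1) WV by (auto simp: S_def)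
  have eq: "a * W + V = 3/2" using K by (simp add: a_def)
  have "a \<le> (3/2 - y0) / x0" using w(2)[of "(x0,y0)"] \<open>(x0,y0) \<in> S\<close> by (simp add: a_def WV)
  also have "\<dots> < 1" using \<open>(x0,y0) \<in> S\<close> assms by (simp add: S_def field_simps)
  finally have a1: "a < 1" .
  have a2: "1/2 \<le> a" using K le1[OF K(1)] by (simp add: a_def field_simps)
  have "a * x + y \<le> 3/2" if u: "(x,y) \<in> K" for x y
  proof (cases "1/2 \<le> x")
    case True
    then have "a \<le> (3/2 - y) / x" using w(2)[of "(x,y)"] u by (simp add: a_def WV S_def)
    then show ?thesis using True by (simp add: field_simps)
  next
    case False
    have "a * x \<le> 1/2"
    proof (cases "x \<le> 0")
      case True then show ?thesis using a2 mult_nonneg_nonpos[of a x] by simp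
    next
      case F2: False then show ?thesis using False a1 a2 mult_mono[of a 1 x "1/2"] by simp
    qed
    then show ?thesis using le1[OF u] by simp
  qed
  then show ?thesis using that a1 a2 K(1) eq by blast
qed

text \<open>
  Pairs of a slope \<open>\<rho>\<close> and a point where \<open>K\<close> is supported with this slope. Since \<open>K\<close> need not be smooth
  or strictly convex, the intermediate value argument along its boundary is carried out as a
  connectedness argument on this set.
\<close>

definition face_graph :: "real \<Rightarrow> real \<Rightarrow> (real \<times> real \<times> real) set" where
  "face_graph a c = {(\<rho>,z). a \<le> \<rho> \<and> \<rho> \<le> c \<and> z \<in> K \<and> (\<forall>v\<in>K. \<rho> * fst v + snd v \<le> \<rho> * fst z + snd z)}"

lemma face_graphD:
  assumes "(\<rho>,z) \<in> face_graph a c"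
  shows "a \<le> \<rho>" "\<rho> \<le> c" "z \<in> K" "v \<in> K \<Longrightarrow> \<rho> * fst v + snd v \<le> \<rho> * fst z + snd z"
  using assms by (auto simp: face_graph_def)

lemma compact_face_graph: "compact (face_graph a c)"
proof -
  have "face_graph a c = ({a..c} \<times> K) \<inter> (\<Inter>v\<in>K. {P. fst P * fst v + snd v \<le> fst P * fst (snd P) + snd (snd P)})"
    by (intro set_eqI) (simp add: face_graph_def case_prod_beta mem_Times_iff; blast)
  moreover have "closed (\<Inter>v\<in>K. {P. fst P * fst v + snd v \<le> fst P * fst (snd P) + snd (snd P)})"
    by (intro closed_INT ballI closed_Collect_le continuous_intros)
  ultimately show ?thesis
    using compact by (auto intro!: compact_Int_closed compact_Times)
qed

text \<open>Projection to the slope is a closed map onto an interval whose fibres are faces of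
  \<open>K\<close>, hence convex; connectedness lifts along such a map.\<close>

lemma connected_face_graph: "connected (face_graph a c)"
proof -
  have img: "fst ` face_graph a c = {a..c}"
  proof (intro equalityI subsetI)
    fix \<rho> assume \<rho>: "\<rho> \<in> {a..c}"
    have "K \<noteq> {}" using e1 by auto
    moreover have "continuous_on K (\<lambda>z. \<rho> * fst z + snd z)" by (intro continuous_intros)
    ultimately obtain z where "z \<in> K" "\<forall>v\<in>K. \<rho> * fst v + snd v \<le> \<rho> * fst z + snd z"
      using continuous_attains_sup[OF compact] by blast
    then have "(\<rho>,z) \<in> face_graph a c" using \<rho> by (auto simp: face_graph_def)
    then show "\<rho> \<in> fst ` face_graph a c" by force
  qed (auto simp: face_graph_def)
  have "connected (face_graph a c \<inter> fst -` {a..c})"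
  proof (rule connected_closed_monotone_preimage[where T="{a..c}"])
    show "continuous_on (face_graph a c) fst" by (intro continuous_intros)
    show "fst ` face_graph a c = {a..c}" by (rule img)
    fix C assume "closedin (top_of_set (face_graph a c)) C"
    then have "compact C" using compact_face_graph closedin_compact by blast
    then have "compact (fst ` C)" by (intro compact_continuous_image continuous_intros)
    moreover have "fst ` C \<subseteq> {a..c}"
      using img closedin_subset[OF \<open>closedin _ C\<close>] by (metis image_mono topspace_euclidean_subtopology)
    ultimately show "closedin (top_of_set {a..c}) (fst ` C)"
      by (simp add: closed_subset compact_imp_closed)
  next
    fix \<rho> assume "\<rho> \<in> {a..c}"
    have "face_graph a c \<inter> fst -` {\<rho>} = {\<rho>} \<times> {z. (\<rho>,z) \<in> face_graph a c}" by auto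
    moreover have "convex {z. (\<rho>,z) \<in> face_graph a c}"
    proof (rule convexI)
      fix z z' and s t :: real
      assume z: "z \<in> {z. (\<rho>,z) \<in> face_graph a c}" "z' \<in> {z. (\<rho>,z) \<in> face_graph a c}" and st: "0 \<le> s" "0 \<le> t" "s + t = 1"
      have "\<rho> * fst v + snd v \<le> \<rho> * fst (s *\<^sub>R z + t *\<^sub>R z') + snd (s *\<^sub>R z + t *\<^sub>R z')" if "v \<in> K" for v
      proof -
        have "\<rho> * fst v + snd v = s * (\<rho> * fst v + snd v) + t * (\<rho> * fst v + snd v)"
          using st by (metis distrib_right mult_1)
        also have "\<dots> \<le> s * (\<rho> * fst z + snd z) + t * (\<rho> * fst z' + snd z')"
          using st face_graphD(4)[of \<rho> z] face_graphD(4)[of \<rho> z'] z that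
          by (intro add_mono[OF mult_left_mono mult_left_mono]) auto
        finally show ?thesis by (simp add: algebra_simps)
      qed
      then show "s *\<^sub>R z + t *\<^sub>R z' \<in> {z. (\<rho>,z) \<in> face_graph a c}"
        using z st convexD[OF convex] by (auto simp: face_graph_def)
    qed
    ultimately show "connected (face_graph a c \<inter> fst -` {\<rho>})"
      by (auto intro: convex_connected convex_Times)
  qed auto
  moreover have "face_graph a c \<inter> fst -` {a..c} = face_graph a c" by (auto simp: face_graph_def)
  ultimately show ?thesis by simp
qed

text \<open>The slopes run between the tangents from \<open>(0, 3/2)\<close> and from
  \<open>(3/2, 0)\<close>, which keeps \<open>f1\<close> and \<open>f2\<close> in
  \<open>snug_if_support\<close> at most 2/3. The two conditions \<open>g\<close> there, multiplied
  by the support value, define closed sets that cover the connected face graph; as both meet it,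
  they have a common point on it.\<close>

lemma snug_if_between:
  assumes a: "1/2 \<le> a" "a < 1" and w: "(W,V) \<in> K" "a * W + V = 3/2"
    and a': "1/2 \<le> a'" "a' < 1" and w': "(W',V') \<in> K" "W' + a' * V' = 3/2"
    and g1: "(\<rho>1,x1,y1) \<in> face_graph a (1/a')" "2 * (\<rho>1 * x1 + y1 - \<rho>1) \<le> y1 * (\<rho>1 * x1 + y1)"
    and g2: "(\<rho>2,x2,y2) \<in> face_graph a (1/a')" "2 * (\<rho>2 * x2 + y2 - 1) \<le> x2 * (\<rho>2 * x2 + y2)"
  shows "snug_pair K"
proof -
  let ?\<Gamma> = "face_graph a (1/a')"
  let ?f = "\<lambda>P::real\<times>real\<times>real. fst P * fst (snd P) + snd (snd P)"
  let ?A = "{P. 2 * (?f P - fst P) \<le> snd (snd P) * ?f P}"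
  let ?B = "{P. 2 * (?f P - 1) \<le> fst (snd P) * ?f P}"
  have f: "3/2 \<le> \<rho> * x + y \<and> 3/2 * \<rho> \<le> \<rho> * x + y \<and> 0 < x \<and> 0 < y \<and> 0 < \<rho>" if "(\<rho>,x,y) \<in> ?\<Gamma>" for \<rho> x y
  proof -
    have \<rho>: "a \<le> \<rho>" "\<rho> * a' \<le> 1" "0 < \<rho>" using face_graphD(1,2)[OF that] a a' by (auto simp: field_simps)
    have K: "(x,y) \<in> K" and m: "\<rho> * W + V \<le> \<rho> * x + y" "\<rho> * W' + V' \<le> \<rho> * x + y"
      using face_graphD(3)[OF that] face_graphD(4)[OF that w(1)] face_graphD(4)[OF that w'(1)] by simp_all
    have W: "0 \<le> W" "0 \<le> V'"
    proof -
      have "1/2 \<le> a * W" using w(2) le1[OF w(1)] by linarith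
      then show "0 \<le> W" using a mult_nonneg_nonpos[of a W] by linarith
      have "1/2 \<le> a' * V'" using w'(2) le1[OF w'(1)] by linarith
      then show "0 \<le> V'" using a' mult_nonneg_nonpos[of a' V'] by linarith
    qed
    have 1: "3/2 \<le> \<rho> * x + y" using m(1) w(2) mult_right_mono[OF \<rho>(1) W(1)] by linarith
    have "\<rho> * (3/2) = \<rho> * W' + (\<rho> * a') * V'" unfolding w'(2)[symmetric] by (simp add: algebra_simps)
    also have "\<dots> \<le> \<rho> * W' + 1 * V'" using \<rho> W by (intro add_left_mono mult_right_mono) auto
    finally have 2: "3/2 * \<rho> \<le> \<rho> * x + y" using m(2) by linarith
    have "0 < \<rho> * x" using 1 le1[OF K] by linarith
    then have x: "0 < x" using \<rho>(3) by (simp add: zero_less_mult_iff)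
    have "\<rho> * x \<le> \<rho> * 1" using le1[OF K] \<rho>(3) by (intro mult_left_mono) auto
    then have "0 < y" using 2 \<rho>(3) by linarith
    then show ?thesis using 1 2 x \<rho> by auto
  qed
  have cover: "P \<in> ?A \<or> P \<in> ?B" if "P \<in> ?\<Gamma>" for P
  proof (rule ccontr)
    obtain \<rho> x y where P: "P = (\<rho>,x,y)" by (cases P)
    assume "\<not> ?thesis"
    then have n: "y * (\<rho> * x + y) < 2 * (\<rho> * x + y - \<rho>)" "x * (\<rho> * x + y) < 2 * (\<rho> * x + y - 1)" by (auto simp: P)
    have fP: "3/2 \<le> \<rho> * x + y" "0 < x" "0 < y" using f that P by auto
    have K: "(x,y) \<in> K" using that by (simp add: P face_graph_def)
    \<comment> \<open>Weighted by \<open>x\<close> and \<open>y\<close> and added, the two failures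
      leave \<open>x * y < x + y - 1\<close>, that is \<open>(1 - x) * (1 - y) < 0\<close>.\<close>
    have "x * (y * (\<rho> * x + y)) + y * (x * (\<rho> * x + y)) < x * (2 * (\<rho> * x + y - \<rho>)) + y * (2 * (\<rho> * x + y - 1))"
      using n fP by (intro add_strict_mono mult_strict_left_mono) auto
    then have "(\<rho> * x + y) * (x * y) < (\<rho> * x + y) * (x + y - 1)" by (simp add: algebra_simps)
    then have "x * y < x + y - 1" using fP by simp
    moreover have "0 \<le> (1 - x) * (1 - y)" using le1[OF K] by simp
    ultimately show False by (simp add: algebra_simps)
  qed
  have "closed ?A" "closed ?B" by (intro closed_Collect_le continuous_intros)+
  moreover have "?\<Gamma> \<subseteq> ?A \<union> ?B" using cover by blast
  moreover have "(\<rho>1,x1,y1) \<in> ?A \<inter> ?\<Gamma>" "(\<rho>2,x2,y2) \<in> ?B \<inter> ?\<Gamma>" using g1 g2 by simp_all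
  then have "?A \<inter> ?\<Gamma> \<noteq> {}" "?B \<inter> ?\<Gamma> \<noteq> {}" by blast+
  ultimately have "?A \<inter> ?B \<inter> ?\<Gamma> \<noteq> {}"
    using connected_face_graph[of a "1/a'", unfolded connected_closed] by blast
  then obtain \<rho> x y where P: "(\<rho>,x,y) \<in> ?\<Gamma>" "2 * (\<rho> * x + y - \<rho>) \<le> y * (\<rho> * x + y)" "2 * (\<rho> * x + y - 1) \<le> x * (\<rho> * x + y)"
    by auto
  define h where "h = \<rho> * x + y"
  have h: "3/2 \<le> h" "3/2 * \<rho> \<le> h" using f[OF P(1)] by (auto simp: h_def)
  show ?thesis
  proof (rule snug_if_support[of x y "\<rho>/h" "1/h"])
    show "(x,y) \<in> K" using P(1) by (simp add: face_graph_def)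
    show "\<rho>/h * x' + 1/h * y' \<le> 1" if "(x',y') \<in> K" for x' y'
    proof -
      have "\<rho> * x' + y' \<le> h" using face_graphD(4)[OF P(1) that] by (simp add: h_def)
      then have "(\<rho> * x' + y') / h \<le> 1" using h by simp
      then show ?thesis by (simp add: add_divide_distrib)
    qed
    show "\<rho>/h * x + 1/h * y = 1" using h by (simp add: h_def add_divide_distrib[symmetric])
    show "\<rho>/h \<le> 2/3" "1/h \<le> 2/3" using h by (auto simp: field_simps)
    show "2 * (1 - \<rho>/h) \<le> y" "2 * (1 - 1/h) \<le> x" using P(2,3) h unfolding h_def[symmetric] by (auto simp: field_simps)
  qed
qed

text \<open>For the case that a condition \<open>g\<close> of \<open>snug_if_support\<close> holds
  nowhere on the face graph. \<open>snug_if_low\<close> is applied with \<open>p\<close> the point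
  where the line \<open>a * x + y = 1\<close> meets the segment from \<open>(1,0)\<close> to a
  touching point: to \<open>(W,V)\<close> for \<open>5/6 \<le> a\<close>, to \<open>(W',V')\<close>
  otherwise.\<close>

lemma snug_if_start_low:
  assumes a: "1/2 \<le> a" "a < 1" and w: "(W,V) \<in> K" "a * W + V = 3/2" and supp: "\<And>x y. (x,y) \<in> K \<Longrightarrow> a * x + y \<le> 3/2"
    and a': "1/2 \<le> a'" "a' < 1" and w': "(W',V') \<in> K" "W' + a' * V' = 3/2" and supp': "\<And>x y. (x,y) \<in> K \<Longrightarrow> x + a' * y \<le> 3/2"
    and low: "V' < 2/3" and high: "2/3 \<le> W"
  shows "snug_pair K"
proof (cases "5/6 \<le> a")
  case True
  \<comment> \<open>\<open>5/6 \<le> a\<close> is exactly \<open>4 * t \<le> 1\<close>, from which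
    the condition on \<open>p1\<close> follows.\<close>
  define t where "t = (1 - a) / (3/2 - a)"
  have t: "0 \<le> t" "t \<le> 1" "t * (3/2 - a) = 1 - a" "4 * t \<le> 1"
    using a True by (auto simp: t_def field_simps)
  define D where "D = 1 - W"
  have W1: "W \<le> 1" "0 \<le> D" using le1[OF w(1)] by (auto simp: D_def)
  have p: "(1 + t * (W - 1), 0 + t * (V - 0)) \<in> K" by (rule segment[OF e1 w(1) t(1,2)])
  have tD: "t * D \<le> D" using t W1 by (simp add: mult_left_le_one_le)
  have p1: "1 + t * (W - 1) = 1 - t * D" by (simp add: D_def algebra_simps)
  show ?thesis
  proof (rule snug_if_low[OF p _ _ _ supp w high])
    show "0 < 1 + t * (W - 1)" using p1 tD high by (simp add: D_def)
    have "a * (1 + t * (W - 1)) + (0 + t * (V - 0)) = a + t * (a * W + V - a)" by (simp add: algebra_simps)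
    then show "a * (1 + t * (W - 1)) + (0 + t * (V - 0)) = 1" using w(2) t(3) by simp
    have "(t * D) * (4 - 3 * D) \<le> (t * D) * 4" using W1 t by (intro mult_left_mono) auto
    also have "\<dots> = (4 * t) * D" by simp
    also have "\<dots> \<le> D" using t W1 by (intro mult_left_le_one_le) auto
    finally have "(t * D) * (4 - 3 * D) \<le> D" .
    moreover have W: "W = 1 - D" by (simp add: D_def)
    ultimately show "4 * W \<le> (1 + t * (W - 1)) * (3 * W + 1)" unfolding p1 unfolding W by (simp add: algebra_simps)
  qed (use a in auto)
next
  case False
  define D D' e where "D = 1 - W'" and "D' = 1 - W" and "e = 1 - a"
  have e: "1/6 < e" "e \<le> 1/2" "a = 1 - e" using False a by (auto simp: e_def)
  have D': "0 \<le> D'" "D' \<le> 1/3" "W = 1 - D'" using le1[OF w(1)] high by (auto simp: D'_def)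
  have W': "W' = 1 - D" by (simp add: D_def)
  have V'pos: "0 < V'"
  proof (rule ccontr)
    assume "\<not> 0 < V'"
    then have "a' * V' \<le> 0" using a' by (simp add: mult_nonneg_nonpos)
    then show False using w'(2) le1[OF w'(1)] by linarith
  qed
  have aV: "a' * V' = 1/2 + D" using w'(2) by (simp add: D_def)
  have D: "0 \<le> D" "1/2 + D \<le> V'" "D \<le> 1/6"
  proof -
    show "0 \<le> D" using le1[OF w'(1)] by (simp add: D_def)
    have "a' * V' \<le> 1 * V'" using a' V'pos by (intro mult_right_mono) auto
    then show "1/2 + D \<le> V'" using aV by simp
    then show "D \<le> 1/6" using low by simp
  qed
  have V: "V = 1/2 + e + (1 - e) * D'" using w(2) unfolding e(3) D'(3) by (simp add: algebra_simps)
  have Vpos: "0 < V" using V e D' by (simp add: add_pos_nonneg)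
  \<comment> \<open>The second tangent bounds \<open>(W,V)\<close>; multiplying by \<open>V'\<close>
    makes \<open>a'\<close> occur only in the known product \<open>a' * V'\<close>.\<close>
  have key: "V * (1 + 2 * D) \<le> V' * (1 + 2 * D')"
  proof -
    have "V' * W + (a' * V') * V \<le> V' * (3/2)"
      using mult_left_mono[OF supp'[OF w(1)], of V'] V'pos by (simp add: algebra_simps)
    then show ?thesis unfolding aV D'(3) by (simp add: algebra_simps)
  qed
  have key2: "V * (1 + 2 * D) \<le> 2/3 * (1 + 2 * D')"
    using key mult_right_mono[of V' "2/3" "1 + 2 * D'"] low D' by linarith
  \<comment> \<open>With \<open>t \<le> 2 * e\<close> below this gives
    \<open>4 * t * D \<le> D'\<close>, which implies the condition on \<open>p1\<close>.\<close>
  have eD: "8 * e * D \<le> D'"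
  proof -
    have quad: "8/3 * e + 16/3 * (e * D') \<le> D' * V + 4 * e * V"
    proof -
      have "D' * V + 4 * e * V - (8/3 * e + 16/3 * (e * D')) = 4 * e * (e - 1/6) + D' * (1/2 - e/3 - 4 * e^2) + (1 - e) * D'^2"
        unfolding V by (simp add: algebra_simps power2_eq_square)
      also have "\<dots> \<ge> 0"
      proof -
        have 1: "0 \<le> (1 - e) * D'^2" using e by simp
        \<comment> \<open>Affine in \<open>D'\<close>, so only the ends of
          \<open>0 \<le> D' \<le> 1/3\<close> matter: at 0 the value is non-negative by
          \<open>1/6 < e\<close>, at 1/3 by completing the square.\<close>
        have "0 \<le> 4 * e * (e - 1/6) + D' * (1/2 - e/3 - 4 * e^2)"
        proof (cases "0 \<le> 1/2 - e/3 - 4 * e^2")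
          case True then show ?thesis using e D' by simp
        next
          case neg: False
          have "1/3 * (1/2 - e/3 - 4 * e^2) \<le> D' * (1/2 - e/3 - 4 * e^2)"
            using neg D' by (intro mult_right_mono_neg) auto
          moreover have "0 \<le> 4 * e * (e - 1/6) + 1/3 * (1/2 - e/3 - 4 * e^2)"
          proof -
            have "4 * e * (e - 1/6) + 1/3 * (1/2 - e/3 - 4 * e^2) = 8/3 * (e - 7/48)^2 + (1/6 - 8/3 * (7/48)^2)"
              by (simp add: algebra_simps power2_eq_square)
            also have "\<dots> \<ge> 0" by (intro add_nonneg_nonneg) (auto simp: power2_eq_square)
            finally show ?thesis .
          qed
          ultimately show ?thesis by linarith
        qed
        then show ?thesis using 1 by linarith
      qed
      finally show ?thesis by linarith
    qed
    have "V * (8 * e * D) = 4 * e * (V * (1 + 2 * D)) - 4 * e * V" by (simp add: algebra_simps)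
    also have "\<dots> \<le> 4 * e * (2/3 * (1 + 2 * D')) - 4 * e * V"
      using key2 e by (intro diff_right_mono mult_left_mono) auto
    also have "\<dots> \<le> V * D'" using quad by (simp add: algebra_simps)
    finally show ?thesis using Vpos by simp
  qed
  define m where "m = V' - a * D"
  have m: "1/2 \<le> m"
    using mult_right_mono[of a 1 D] a D by (simp add: m_def)
  define t where "t = e / m"
  have t: "0 \<le> t" "t \<le> 2 * e" "t \<le> 1" "t * m = e"
  proof -
    show "t * m = e" "0 \<le> t" using m e by (auto simp: t_def)
    have "e * 1 \<le> e * (2 * m)" using m e by (intro mult_left_mono) auto
    then show "t \<le> 2 * e" using m by (simp add: t_def field_simps)
    then show "t \<le> 1" using e by simp
  qed
  have p: "(1 + t * (W' - 1), 0 + t * (V' - 0)) \<in> K" by (rule segment[OF e1 w'(1) t(1) t(3)])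
  have p1: "1 + t * (W' - 1) = 1 - t * D" by (simp add: D_def algebra_simps)
  have tD: "t * D \<le> D" using t D by (simp add: mult_left_le_one_le)
  show ?thesis
  proof (rule snug_if_low[OF p _ _ _ supp w high])
    show "0 < 1 + t * (W' - 1)" using p1 tD D by simp
    have "a * (1 + t * (W' - 1)) + (0 + t * (V' - 0)) = a + t * m" by (simp add: m_def D_def algebra_simps)
    then show "a * (1 + t * (W' - 1)) + (0 + t * (V' - 0)) = 1" using t(4) e by simp
    have "(t * D) * (4 - 3 * D') \<le> (t * D) * 4" using D D' t by (intro mult_left_mono) auto
    also have "\<dots> \<le> (2 * e * D) * 4" using t D by (intro mult_right_mono) auto
    also have "\<dots> \<le> D'" using eD by simp
    finally have "(t * D) * (4 - 3 * D') \<le> D'" .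
    then show "4 * W \<le> (1 + t * (W' - 1)) * (3 * W + 1)" unfolding p1 unfolding D'(3) by (simp add: algebra_simps)
  qed (use a in auto)
qed

section \<open>Symmetries of the normalised body, and the general case\<close>

lemma swapped: "auerbach ((\<lambda>z. (snd z, fst z)) ` K)"
proof
  have lin: "linear (\<lambda>z::real\<times>real. (snd z, fst z))" by (auto intro!: linearI)
  show "compact ((\<lambda>z. (snd z, fst z)) ` K)"
    by (intro compact_continuous_image compact continuous_intros)
  show "convex ((\<lambda>z. (snd z, fst z)) ` K)" by (rule convex_linear_image[OF lin convex])
  show "(1,0) \<in> (\<lambda>z. (snd z, fst z)) ` K" "(0,1) \<in> (\<lambda>z. (snd z, fst z)) ` K" using e1 e2 by force+
  fix x y x' y' :: real assume "(x,y) \<in> (\<lambda>z. (snd z, fst z)) ` K"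
  then have 1: "(y,x) \<in> K" by auto
  show "(-x,-y) \<in> (\<lambda>z. (snd z, fst z)) ` K" using sym[OF 1] by force
  assume "(x',y') \<in> (\<lambda>z. (snd z, fst z)) ` K"
  then have "(y',x') \<in> K" by auto
  then show "x * y' - y * x' \<le> 1" using det_le[of y' x' y x] 1 by (simp add: algebra_simps)
qed

lemma reflected: "auerbach ((\<lambda>z. (fst z, - snd z)) ` K)"
proof
  have lin: "linear (\<lambda>z::real\<times>real. (fst z, - snd z))" by (auto intro!: linearI)
  show "compact ((\<lambda>z. (fst z, - snd z)) ` K)"
    by (intro compact_continuous_image compact continuous_intros)
  show "convex ((\<lambda>z. (fst z, - snd z)) ` K)" by (rule convex_linear_image[OF lin convex])
  show "(1,0) \<in> (\<lambda>z. (fst z, - snd z)) ` K" using e1 by force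
  show "(0,1) \<in> (\<lambda>z. (fst z, - snd z)) ` K" using sym[OF e2] by force
  fix x y x' y' :: real assume "(x,y) \<in> (\<lambda>z. (fst z, - snd z)) ` K"
  then have 1: "(x,-y) \<in> K" by auto
  show "(-x,-y) \<in> (\<lambda>z. (fst z, - snd z)) ` K" using sym[OF 1] by force
  assume "(x',y') \<in> (\<lambda>z. (fst z, - snd z)) ` K"
  then have "(x',-y') \<in> K" by auto
  then show "x * y' - y * x' \<le> 1" using det_le[of x' "-y'" x "-y"] 1 by (simp add: algebra_simps)
qed

lemma snug_swapped:
  assumes "snug_pair ((\<lambda>z. (snd z, fst z)) ` K)"
  shows "snug_pair K"
proof -
  have mem: "(x,y) \<in> (\<lambda>z. (snd z, fst z)) ` K \<longleftrightarrow> (y,x) \<in> K" for x y by force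
  obtain p1 p2 q1 q2 where p: "(p2,p1) \<in> K" "(q2,q1) \<in> K" "0 < p1 * q2 - p2 * q1"
    and b: "\<And>x y. (y,x) \<in> K \<Longrightarrow> x * (q2 - p2) - y * (q1 - p1) \<le> 3/2 * (p1 * q2 - p2 * q1)"
      "\<And>x y. (y,x) \<in> K \<Longrightarrow> x * (q2 + p2) - y * (q1 + p1) \<le> 3/2 * (p1 * q2 - p2 * q1)"
    using assms unfolding snug_pair_def mem by blast
  show ?thesis unfolding snug_pair_def
    apply (rule exI[of _ q2], rule exI[of _ q1], rule exI[of _ p2], rule exI[of _ p1])
    using p b(1) b(2)[OF sym] by (auto simp: algebra_simps)
qed

lemma snug_reflected:
  assumes "snug_pair ((\<lambda>z. (fst z, - snd z)) ` K)"
  shows "snug_pair K"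
proof -
  have mem: "(x,y) \<in> (\<lambda>z. (fst z, - snd z)) ` K \<longleftrightarrow> (x,-y) \<in> K" for x y by force
  obtain p1 p2 q1 q2 where p: "(p1,-p2) \<in> K" "(q1,-q2) \<in> K" "0 < p1 * q2 - p2 * q1"
    and b: "\<And>x y. (x,-y) \<in> K \<Longrightarrow> x * (q2 - p2) - y * (q1 - p1) \<le> 3/2 * (p1 * q2 - p2 * q1)"
      "\<And>x y. (x,-y) \<in> K \<Longrightarrow> x * (q2 + p2) - y * (q1 + p1) \<le> 3/2 * (p1 * q2 - p2 * q1)"
    using assms unfolding snug_pair_def mem by blast
  have b': "x * (q2 - p2) + y * (q1 - p1) \<le> 3/2 * (p1 * q2 - p2 * q1)"
    "- x * (q2 + p2) - y * (q1 + p1) \<le> 3/2 * (p1 * q2 - p2 * q1)" if "(x,y) \<in> K" for x y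
    using b(1)[of x "-y"] b(2)[of "-x" "y"] sym[OF that] that by auto
  show ?thesis unfolding snug_pair_def
    apply (rule exI[of _ q1], rule exI[of _ "-q2"], rule exI[of _ p1], rule exI[of _ "-p2"])
    using p b' by (auto simp: algebra_simps)
qed

end

text \<open>If one of the two conditions holds nowhere on the face graph, its failure at both
  extreme slopes yields the hypotheses of \<open>snug_if_start_low\<close>, for the swapped body in
  the case of the second condition.\<close>

lemma (in auerbach) snug_if_bulge:
  assumes "(x0,y0) \<in> K" "3/2 < x0 + y0"
  shows "snug_pair K"
proof -
  let ?K = "(\<lambda>z. (snd z, fst z)) ` K"
  interpret S: auerbach ?K by (rule swapped)
  have mem: "(x,y) \<in> ?K \<longleftrightarrow> (y,x) \<in> K" for x y by force
  obtain a W V where a: "1/2 \<le> a" "a < 1" and w: "(W,V) \<in> K" "a * W + V = 3/2"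
    and supp: "\<And>x y. (x,y) \<in> K \<Longrightarrow> a * x + y \<le> 3/2"
    using extreme_slope[OF assms] by metis
  have "(y0,x0) \<in> ?K" "3/2 < y0 + x0" using assms mem by auto
  then obtain a' W' V' where a': "1/2 \<le> a'" "a' < 1" and w': "(W',V') \<in> K" "W' + a' * V' = 3/2"
    and supp': "\<And>x y. (x,y) \<in> K \<Longrightarrow> x + a' * y \<le> 3/2"
    using S.extreme_slope[of y0 x0] mem by (smt (verit))
  have le: "a \<le> 1/a'" using a a' by (simp add: field_simps mult_le_one)
  have at_inv_a': "(1/a',W',V') \<in> face_graph a (1/a')"
  proof -
    have "1/a' * x + y \<le> 1/a' * W' + V'" if "(x,y) \<in> K" for x y
    proof -
      have split: "1/a' * u + v = (u + a' * v) / a'" for u v using a' by (simp add: field_simps)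
      show ?thesis unfolding split w'(2) using supp'[OF that] a' by (intro divide_right_mono) auto
    qed
    then show ?thesis using le w' by (auto simp: face_graph_def)
  qed
  have at_a: "(a,W,V) \<in> face_graph a (1/a')"
  proof -
    have "a * x + y \<le> a * W + V" if "(x,y) \<in> K" for x y using supp[OF that] w(2) by linarith
    then show ?thesis using le w(1) by (auto simp: face_graph_def)
  qed
  consider (mid) \<rho>1 x1 y1 \<rho>2 x2 y2 where
      "(\<rho>1,x1,y1) \<in> face_graph a (1/a')" "2 * (\<rho>1 * x1 + y1 - \<rho>1) \<le> y1 * (\<rho>1 * x1 + y1)"
      "(\<rho>2,x2,y2) \<in> face_graph a (1/a')" "2 * (\<rho>2 * x2 + y2 - 1) \<le> x2 * (\<rho>2 * x2 + y2)"
    | (no1) "\<And>\<rho> x y. (\<rho>,x,y) \<in> face_graph a (1/a') \<Longrightarrow> y * (\<rho> * x + y) < 2 * (\<rho> * x + y - \<rho>)"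
    | (no2) "\<And>\<rho> x y. (\<rho>,x,y) \<in> face_graph a (1/a') \<Longrightarrow> x * (\<rho> * x + y) < 2 * (\<rho> * x + y - 1)"
    by (meson not_le)
  then show ?thesis
  proof cases
    case mid
    then show ?thesis using snug_if_between[OF a w a' w'] by blast
  next
    case no1
    have f: "1/a' * W' + V' = 3/2 * (1/a')" using w'(2) a' by (simp add: field_simps)
    have "V' < 2/3" using no1[OF at_inv_a'] a' unfolding f by (simp add: field_simps)
    moreover have "2/3 \<le> W"
    proof (rule ccontr)
      assume n: "\<not> ?thesis"
      have "V * (3/2) < 2 * (3/2 - a)" using no1[OF at_a] w by simp
      moreover have "V = 3/2 - a * W" using w by simp
      ultimately have "a * (2 - 3/2 * W) < 3/4" by (simp add: algebra_simps)
      moreover have "a * 1 \<le> a * (2 - 3/2 * W)" using n a by (intro mult_left_mono) auto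
      moreover have "a * W \<le> a * (2/3)" using n a by (intro mult_left_mono) auto
      ultimately show False using w(2) le1[OF w(1)] by linarith
    qed
    ultimately show ?thesis using snug_if_start_low[OF a w supp a' w' supp'] by simp
  next
    case no2
    have "W < 2/3" using no2[OF at_a] w by simp
    moreover have "2/3 \<le> V'"
    proof (rule ccontr)
      assume n: "\<not> ?thesis"
      have f: "1/a' * W' + V' = 3/2 * (1/a')" using w'(2) a' by (simp add: field_simps)
      have "W' * (3/2) < 2 * (3/2 - a')" using no2[OF at_inv_a'] a' unfolding f by (simp add: field_simps)
      moreover have "W' = 3/2 - a' * V'" using w' by simp
      ultimately have "a' * (2 - 3/2 * V') < 3/4" by (simp add: algebra_simps)
      moreover have "a' * 1 \<le> a' * (2 - 3/2 * V')" using n a' by (intro mult_left_mono) auto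
      moreover have "a' * V' \<le> a' * (2/3)" using n a' by (intro mult_left_mono) auto
      ultimately show False using w'(2) le1[OF w'(1)] by linarith
    qed
    ultimately have "snug_pair ?K"
      using S.snug_if_start_low[of a' V' W' a V W] a w supp a' w' supp' mem by (simp add: add.commute)
    then show ?thesis by (rule snug_swapped)
  qed
qed

text \<open>Without a bulge the unit vectors themselves form a snug pair; a bulge in the fourth
  quadrant is reflected into the first.\<close>

theorem (in auerbach) snug_pair: "snug_pair K"
proof (cases "\<exists>x y. (x,y) \<in> K \<and> (3/2 < x + y \<or> 3/2 < x - y)")
  case True
  then obtain x y where xy: "(x,y) \<in> K" "3/2 < x + y \<or> 3/2 < x - y" by blast
  let ?K = "(\<lambda>z. (fst z, - snd z)) ` K"
  interpret R: auerbach ?K by (rule reflected)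
  have "(x,-y) \<in> ?K" using xy by force
  then show ?thesis
    using xy snug_if_bulge[of x y] R.snug_if_bulge[of x "-y"] snug_reflected by auto
next
  case False
  then have "x + y \<le> 3/2" "x - y \<le> 3/2" if "(x,y) \<in> K" for x y using that by (auto simp: not_less)
  then show ?thesis unfolding snug_pair_def
    using e1 e2 by - (rule exI[of _ 1], rule exI[of _ 0], rule exI[of _ 0], rule exI[of _ 1], auto)
qed

section \<open>Square coordinates for a symmetric body in the plane\<close>

definition det2 :: "real^2 \<Rightarrow> real^2 \<Rightarrow> real" where
  "det2 u v = u $ 1 * v $ 2 - u $ 2 * v $ 1"

lemma det2_simps [simp]:
  "det2 (u + v) w = det2 u w + det2 v w" "det2 w (u + v) = det2 w u + det2 w v"
  "det2 (a *\<^sub>R u) w = a * det2 u w" "det2 w (a *\<^sub>R u) = a * det2 w u"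
  "det2 (- u) w = - det2 u w" "det2 w (- u) = - det2 w u"
  "det2 (u - v) w = det2 u w - det2 v w" "det2 w (u - v) = det2 w u - det2 w v"
  "det2 u u = 0"
  by (simp_all add: det2_def algebra_simps)

lemma det2_swap: "det2 v u = - det2 u v"
  by (simp add: det2_def)

lemma continuous_on_det2 [continuous_intros]:
  "continuous_on S f \<Longrightarrow> continuous_on S g \<Longrightarrow> continuous_on S (\<lambda>x. det2 (f x) (g x))"
  unfolding det2_def by (intro continuous_intros)

lemma det2_coordinates:
  assumes "det2 p q \<noteq> 0"
  shows "u = (det2 u q / det2 p q) *\<^sub>R p + (det2 p u / det2 p q) *\<^sub>R q"
proof -
  have "det2 p q *\<^sub>R u = det2 u q *\<^sub>R p + det2 p u *\<^sub>R q"
    by (simp add: vec_eq_iff forall_2 det2_def algebra_simps)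
  then have "u = (1 / det2 p q) *\<^sub>R (det2 u q *\<^sub>R p + det2 p u *\<^sub>R q)"
    using assms by (metis divide_inverse_commute mult.right_neutral scaleR_one scaleR_scaleR right_inverse mult.commute)
  then show ?thesis by (simp add: scaleR_add_right)
qed

lemma det2_pos_if_interior:
  assumes sym: "\<And>u. u \<in> C \<Longrightarrow> - u \<in> C" and int: "interior C \<noteq> {}"
  obtains u v where "u \<in> C" "v \<in> C" "0 < det2 u v"
proof -
  obtain z e where e: "0 < e" "cball z e \<subseteq> C"
    using int unfolding mem_interior_cball ex_in_conv[symmetric] by blast
  define b c where "b = z + e *\<^sub>R axis 1 1" and "c = z + e *\<^sub>R axis 2 1"
  have mem: "z \<in> C" "b \<in> C" "c \<in> C" using e by (auto simp: b_def c_def dist_norm norm_axis_1)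
  \<comment> \<open>Twice the area of a triangle is a signed sum of the determinants of pairs of its
    vertices, so one of these is non-zero.\<close>
  have "det2 (b - z) (c - z) = e * e" by (simp add: b_def c_def det2_def axis_def)
  then have "det2 b c - det2 b z - det2 z c = e * e" by simp
  moreover have "0 < e * e" using e by simp
  ultimately consider "det2 b c \<noteq> 0" | "det2 b z \<noteq> 0" | "det2 z c \<noteq> 0" by linarith
  then obtain u v where uv: "u \<in> C" "v \<in> C" "det2 u v \<noteq> 0" using mem by cases blast+
  show ?thesis
  proof (cases "0 < det2 u v")
    case True then show ?thesis using that uv by blast
  next
    case False then show ?thesis using that[of "- u" v] uv sym by simp
  qed
qed

lemma furthest_multiple:
  fixes C :: "'a::euclidean_space set"
  assumes "compact C" "p \<in> C" "p \<noteq> 0"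
  obtains s where "1 \<le> s" "s *\<^sub>R p \<in> C" "\<And>r. r *\<^sub>R p \<in> C \<Longrightarrow> r \<le> s"
proof -
  let ?R = "{r. r *\<^sub>R p \<in> C}"
  have "continuous_on UNIV (\<lambda>r. r *\<^sub>R p)" by (intro continuous_intros)
  then have "closed ?R"
    using closed_vimage[OF compact_imp_closed[OF assms(1)], of "\<lambda>r. r *\<^sub>R p"] by (simp add: vimage_def)
  moreover have "bounded ?R"
  proof -
    obtain M where M: "\<And>x. x \<in> C \<Longrightarrow> norm x \<le> M" using compact_imp_bounded[OF assms(1)] bounded_iff by metis
    have "\<bar>r\<bar> \<le> M / norm p" if "r \<in> ?R" for r
      using M[of "r *\<^sub>R p"] that assms(3) by (simp add: field_simps)
    then show ?thesis unfolding bounded_iff real_norm_def by blast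
  qed
  ultimately have "compact ?R" by (simp add: compact_eq_bounded_closed)
  moreover have "1 \<in> ?R" using assms by simp
  ultimately obtain s where "s \<in> ?R" "\<And>r. r \<in> ?R \<Longrightarrow> r \<le> s"
    using compact_attains_sup[of ?R] by blast
  then show ?thesis using that \<open>1 \<in> ?R\<close> by simp
qed

text \<open>A pair maximising the determinant over \<open>C \<times> C\<close> gives the coordinates
  of \<open>auerbach\<close>. They scale all determinants by \<open>1 / D\<close>, so the snug pair
  can be pulled back; central symmetry merges its inequalities into one with absolute
  values.\<close>

lemma extremal_pair:
  fixes C :: "(real^2) set"
  assumes cpt: "compact C" and conv: "convex C" and sym: "\<And>u. u \<in> C \<Longrightarrow> - u \<in> C" and int: "interior C \<noteq> {}"
  obtains p q where "p \<in> C" "q \<in> C" "0 < det2 p q"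
    "\<And>u. u \<in> C \<Longrightarrow> \<bar>det2 u q\<bar> + \<bar>det2 p u\<bar> \<le> 3/2 * det2 p q"
proof -
  obtain u0 v0 where uv0: "u0 \<in> C" "v0 \<in> C" "0 < det2 u0 v0" using det2_pos_if_interior[OF sym int] .
  have "compact (C \<times> C)" "C \<times> C \<noteq> {}" using cpt uv0 by (auto intro: compact_Times)
  moreover have "continuous_on (C \<times> C) (\<lambda>z. det2 (fst z) (snd z))" by (intro continuous_intros)
  ultimately obtain z where z: "z \<in> C \<times> C" "\<And>y. y \<in> C \<times> C \<Longrightarrow> det2 (fst y) (snd y) \<le> det2 (fst z) (snd z)"
    using continuous_attains_sup[of "C \<times> C" "\<lambda>z. det2 (fst z) (snd z)"] by blast
  define e1 e2 where "e1 = fst z" and "e2 = snd z"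
  have e: "e1 \<in> C" "e2 \<in> C" and max: "\<And>u v. u \<in> C \<Longrightarrow> v \<in> C \<Longrightarrow> det2 u v \<le> det2 e1 e2"
    using z by (auto simp: e1_def e2_def)
  define D where "D = det2 e1 e2"
  have D: "0 < D" using max[OF uv0(1,2)] uv0(3) by (simp add: D_def)
  define \<phi> where "\<phi> u = (det2 u e2 / D, det2 e1 u / D)" for u
  have det_\<phi>: "fst (\<phi> u) * snd (\<phi> v) - snd (\<phi> u) * fst (\<phi> v) = det2 u v / D" for u v
  proof -
    have "det2 u e2 * det2 e1 v - det2 e1 u * det2 v e2 = D * det2 u v"
      by (simp add: D_def det2_def algebra_simps)
    then have "(det2 u e2 * det2 e1 v - det2 e1 u * det2 v e2) / (D * D) = det2 u v / D" using D by simp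
    then show ?thesis by (simp add: \<phi>_def diff_divide_distrib)
  qed
  have lin: "linear \<phi>" by (auto intro!: linearI simp: \<phi>_def add_divide_distrib)
  interpret auerbach "\<phi> ` C"
  proof
    show "compact (\<phi> ` C)" unfolding \<phi>_def using D by (intro compact_continuous_image cpt continuous_intros) auto
    show "convex (\<phi> ` C)" by (rule convex_linear_image[OF lin conv])
    have "\<phi> e1 = (1,0)" "\<phi> e2 = (0,1)" using D by (auto simp: \<phi>_def D_def)
    then show "(1,0) \<in> \<phi> ` C" "(0,1) \<in> \<phi> ` C" using e by (metis imageI)+
    fix x y x' y' assume "(x,y) \<in> \<phi> ` C"
    then obtain u where u: "u \<in> C" "\<phi> u = (x,y)" by auto
    have "\<phi> (- u) = (-x,-y)" using u(2) by (simp add: linear_neg[OF lin])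
    then show "(-x,-y) \<in> \<phi> ` C" using sym[OF u(1)] by (metis imageI)
    assume "(x',y') \<in> \<phi> ` C"
    then obtain v where v: "v \<in> C" "\<phi> v = (x',y')" by auto
    have "x * y' - y * x' = det2 u v / D" using det_\<phi>[of u v] u v by simp
    also have "\<dots> \<le> 1" using max[OF u(1) v(1)] D by (simp add: D_def)
    finally show "x * y' - y * x' \<le> 1" .
  qed
  obtain p1 p2 q1 q2 where pq: "(p1,p2) \<in> \<phi> ` C" "(q1,q2) \<in> \<phi> ` C" "0 < p1 * q2 - p2 * q1"
    and b: "\<And>x y. (x,y) \<in> \<phi> ` C \<Longrightarrow> x * (q2 - p2) - y * (q1 - p1) \<le> 3/2 * (p1 * q2 - p2 * q1)"
      "\<And>x y. (x,y) \<in> \<phi> ` C \<Longrightarrow> x * (q2 + p2) - y * (q1 + p1) \<le> 3/2 * (p1 * q2 - p2 * q1)"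
    using snug_pair unfolding snug_pair_def by blast
  obtain p q where p: "p \<in> C" "\<phi> p = (p1,p2)" and q: "q \<in> C" "\<phi> q = (q1,q2)" using pq by (metis imageE)
  have Dpq: "p1 * q2 - p2 * q1 = det2 p q / D" using det_\<phi>[of p q] p q by simp
  have one: "det2 u q - det2 u p \<le> 3/2 * det2 p q" "det2 u q + det2 u p \<le> 3/2 * det2 p q" if u: "u \<in> C" for u
  proof -
    have *: "fst (\<phi> u) * q2 - snd (\<phi> u) * q1 = det2 u q / D" "fst (\<phi> u) * p2 - snd (\<phi> u) * p1 = det2 u p / D"
      using det_\<phi>[of u q] det_\<phi>[of u p] p q by simp_all
    have m: "(fst (\<phi> u), snd (\<phi> u)) \<in> \<phi> ` C" using u by simp
    have "det2 u q / D - det2 u p / D \<le> 3/2 * (det2 p q / D)" using b(1)[OF m] unfolding Dpq *[symmetric] by (simp add: algebra_simps)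
    then have "(det2 u q - det2 u p) / D \<le> (3/2 * det2 p q) / D" by (simp add: diff_divide_distrib)
    then show "det2 u q - det2 u p \<le> 3/2 * det2 p q" using D by (meson divide_strict_right_mono not_le)
    have "det2 u q / D + det2 u p / D \<le> 3/2 * (det2 p q / D)" using b(2)[OF m] unfolding Dpq *[symmetric] by (simp add: algebra_simps)
    then have "(det2 u q + det2 u p) / D \<le> (3/2 * det2 p q) / D" by (simp add: add_divide_distrib)
    then show "det2 u q + det2 u p \<le> 3/2 * det2 p q" using D by (meson divide_strict_right_mono not_le)
  qed
  show ?thesis
  proof (rule that[OF p(1) q(1)])
    show "0 < det2 p q" using pq(3) D unfolding Dpq by (simp add: zero_less_divide_iff)
    show "\<bar>det2 u q\<bar> + \<bar>det2 p u\<bar> \<le> 3/2 * det2 p q" if "u \<in> C" for u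
      using one[OF that] one[OF assms(3)[OF that]] det2_swap[of p u] by (simp add: abs_if)
  qed
qed

text \<open>
  The vectors \<open>p\<close> and \<open>q\<close> of a snug pair, pushed out to the boundary of \<open>C\<close>, become the corners of the
  inner square. As these lie on the boundary, no point of \<open>C\<close> is beyond a corner in both coordinates.
\<close>

lemma square_coordinates:
  fixes C :: "(real^2) set"
  assumes cpt: "compact C" and conv: "convex C" and sym: "\<And>u. u \<in> C \<Longrightarrow> - u \<in> C" and int: "interior C \<noteq> {}"
  obtains f1 f2 :: "real^2 \<Rightarrow> real" and pt where "linear f1" "linear f2" "\<And>x y. f1 (pt x y) = x" "\<And>x y. f2 (pt x y) = y"
    "\<And>u. \<bar>f1 u\<bar> \<le> 2 \<Longrightarrow> \<bar>f2 u\<bar> \<le> 2 \<Longrightarrow> u \<in> C"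
    "\<And>u. u \<in> C \<Longrightarrow> \<bar>f1 u\<bar> \<le> 3 \<and> \<bar>f2 u\<bar> \<le> 3" "\<And>u. u \<in> C \<Longrightarrow> \<bar>f1 u\<bar> \<le> 2 \<or> \<bar>f2 u\<bar> \<le> 2"
proof -
  obtain p0 q0 where pq0: "p0 \<in> C" "q0 \<in> C" "0 < det2 p0 q0"
    and bound: "\<And>u. u \<in> C \<Longrightarrow> \<bar>det2 u q0\<bar> + \<bar>det2 p0 u\<bar> \<le> 3/2 * det2 p0 q0"
    using extremal_pair[OF assms] by blast
  have "p0 \<noteq> 0" "q0 \<noteq> 0" using pq0(3) by (auto simp: det2_def)
  obtain s where s: "1 \<le> s" "s *\<^sub>R p0 \<in> C" "\<And>r. r *\<^sub>R p0 \<in> C \<Longrightarrow> r \<le> s"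
    using furthest_multiple[OF cpt pq0(1) \<open>p0 \<noteq> 0\<close>] by blast
  obtain t where t: "1 \<le> t" "t *\<^sub>R q0 \<in> C" "\<And>r. r *\<^sub>R q0 \<in> C \<Longrightarrow> r \<le> t"
    using furthest_multiple[OF cpt pq0(2) \<open>q0 \<noteq> 0\<close>] by blast
  define p q where "p = s *\<^sub>R p0" and "q = t *\<^sub>R q0"
  have pq: "p \<in> C" "q \<in> C" using s t by (auto simp: p_def q_def)
  define D where "D = det2 p q"
  have D_eq: "D = s * (t * det2 p0 q0)" by (simp add: D_def p_def q_def)
  have D: "0 < D" unfolding D_eq using pq0(3) s(1) t(1) by (intro mult_pos_pos) auto
  define \<alpha> \<beta> where "\<alpha> u = det2 u q / D" and "\<beta> u = det2 p u / D" for u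
  have split: "u = \<alpha> u *\<^sub>R p + \<beta> u *\<^sub>R q" for u
    using det2_coordinates[of p q u] D by (simp add: \<alpha>_def \<beta>_def D_def)
  have coord: "\<alpha> (x *\<^sub>R p + y *\<^sub>R q) = x" "\<beta> (x *\<^sub>R p + y *\<^sub>R q) = y" for x y
    using D by (simp_all add: \<alpha>_def \<beta>_def D_def)
  have minus: "\<alpha> (- u) = - \<alpha> u" "\<beta> (- u) = - \<beta> u" for u by (simp_all add: \<alpha>_def \<beta>_def)
  have sum: "\<bar>\<alpha> u\<bar> + \<bar>\<beta> u\<bar> \<le> 3/2" if "u \<in> C" for u
  proof -
    have "\<bar>\<alpha> u\<bar> = \<bar>det2 u q0\<bar> / (s * det2 p0 q0)" "\<bar>\<beta> u\<bar> = \<bar>det2 p0 u\<bar> / (t * det2 p0 q0)"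
      using s(1) t(1) pq0(3) by (simp_all add: \<alpha>_def \<beta>_def D_eq p_def q_def abs_mult abs_divide)
    moreover have "\<bar>det2 u q0\<bar> / (s * det2 p0 q0) \<le> \<bar>det2 u q0\<bar> / det2 p0 q0"
      "\<bar>det2 p0 u\<bar> / (t * det2 p0 q0) \<le> \<bar>det2 p0 u\<bar> / det2 p0 q0"
      using s(1) t(1) pq0(3) by (auto intro!: divide_left_mono mult_pos_pos)
    moreover have "\<bar>det2 u q0\<bar> / det2 p0 q0 + \<bar>det2 p0 u\<bar> / det2 p0 q0 \<le> 3/2"
      using bound[OF that] pq0(3) by (simp add: field_simps)
    ultimately show ?thesis by linarith
  qed
  have zero: "0 \<in> C"
    using convexD_alt[OF conv pq(1) sym[OF pq(1)], of "1/2"] by (simp add: algebra_simps)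
  have scaled: "a *\<^sub>R v \<in> C" if "v \<in> C" "\<bar>a\<bar> \<le> 1" for a v
  proof (cases "0 \<le> a")
    case True then show ?thesis using convexD_alt[OF conv zero that(1), of a] that by simp
  next
    case False then show ?thesis using convexD_alt[OF conv zero sym[OF that(1)], of "- a"] that by simp
  qed
  have combine: "(1 / (1 + \<bar>b\<bar>)) *\<^sub>R (u + b *\<^sub>R v) \<in> C" if "u \<in> C" "v \<in> C" for u v b
  proof -
    have "(1 / (1 + \<bar>b\<bar>)) *\<^sub>R u + (\<bar>b\<bar> / (1 + \<bar>b\<bar>)) *\<^sub>R (sgn b *\<^sub>R v) \<in> C"
      using that scaled[of v "sgn b"] by (intro convexD[OF conv]) (auto simp: abs_sgn_eq add_divide_distrib[symmetric])
    moreover have "\<bar>b\<bar> / (1 + \<bar>b\<bar>) * sgn b = b / (1 + \<bar>b\<bar>)" by (simp add: abs_mult_sgn)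
    ultimately show ?thesis by (simp add: scaleR_add_right abs_mult_sgn)
  qed
  \<comment> \<open>Cancelling the \<open>q\<close> component of \<open>u\<close> by
    \<open>combine\<close> leaves \<open>\<alpha> u / (1 + \<bar>\<beta> u\<bar>)\<close> times
    \<open>p\<close>, and \<open>p\<close> is the furthest point of \<open>C\<close> on its
    ray.\<close>
  have half_\<alpha>: "\<alpha> u \<le> 1 + \<bar>\<beta> u\<bar>" if "u \<in> C" for u
  proof -
    have "u + (- \<beta> u) *\<^sub>R q = \<alpha> u *\<^sub>R p" using split[of u] by (simp add: algebra_simps)
    then have "(\<alpha> u / (1 + \<bar>\<beta> u\<bar>) * s) *\<^sub>R p0 \<in> C"
      using combine[OF that pq(2), of "- \<beta> u"] by (simp add: p_def)
    then have "\<alpha> u / (1 + \<bar>\<beta> u\<bar>) * s \<le> 1 * s" using s(3) by simp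
    then have le: "\<alpha> u / (1 + \<bar>\<beta> u\<bar>) \<le> 1" using s(1) by (intro mult_right_le_imp_le[of _ s 1]) auto
    have pos: "0 < 1 + \<bar>\<beta> u\<bar>" by linarith
    from iffD1[OF pos_divide_le_eq[OF pos] le] show ?thesis by simp
  qed
  have half_\<beta>: "\<beta> u \<le> 1 + \<bar>\<alpha> u\<bar>" if "u \<in> C" for u
  proof -
    have "u + (- \<alpha> u) *\<^sub>R p = \<beta> u *\<^sub>R q" using split[of u] by (simp add: algebra_simps)
    then have "(\<beta> u / (1 + \<bar>\<alpha> u\<bar>) * t) *\<^sub>R q0 \<in> C"
      using combine[OF that pq(1), of "- \<alpha> u"] by (simp add: q_def)
    then have "\<beta> u / (1 + \<bar>\<alpha> u\<bar>) * t \<le> 1 * t" using t(3) by simp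
    then have le: "\<beta> u / (1 + \<bar>\<alpha> u\<bar>) \<le> 1" using t(1) by (intro mult_right_le_imp_le[of _ t 1]) auto
    have pos: "0 < 1 + \<bar>\<alpha> u\<bar>" by linarith
    from iffD1[OF pos_divide_le_eq[OF pos] le] show ?thesis by simp
  qed
  show ?thesis
  \<comment> \<open>Sum and difference turn the parallelogram with vertices \<open>p\<close>,
    \<open>q\<close> and their negatives into an axis-parallel square; the factor 2 clears the
    denominator of 3/2.\<close>
  proof (rule that[of "\<lambda>u. 2 * (\<alpha> u + \<beta> u)" "\<lambda>u. 2 * (\<alpha> u - \<beta> u)" "\<lambda>x y. ((x + y) / 4) *\<^sub>R p + ((x - y) / 4) *\<^sub>R q"])
    show "linear (\<lambda>u. 2 * (\<alpha> u + \<beta> u))" "linear (\<lambda>u. 2 * (\<alpha> u - \<beta> u))"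
      by (auto intro!: linearI simp: \<alpha>_def \<beta>_def add_divide_distrib diff_divide_distrib algebra_simps)
    show "u \<in> C" if "\<bar>2 * (\<alpha> u + \<beta> u)\<bar> \<le> 2" "\<bar>2 * (\<alpha> u - \<beta> u)\<bar> \<le> 2" for u
    proof -
      have "\<alpha> u + \<beta> u \<le> 1" "- 1 \<le> \<alpha> u + \<beta> u" "\<alpha> u - \<beta> u \<le> 1" "- 1 \<le> \<alpha> u - \<beta> u"
        using that by (simp_all add: abs_le_iff)
      then have le: "\<bar>\<alpha> u\<bar> + \<bar>\<beta> u\<bar> \<le> 1" by linarith
      have "\<bar>\<alpha> u\<bar> *\<^sub>R (sgn (\<alpha> u) *\<^sub>R p) + \<bar>\<beta> u\<bar> *\<^sub>R (sgn (\<beta> u) *\<^sub>R q) \<in> C"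
      proof -
        have "sgn (\<alpha> u) *\<^sub>R p \<in> C" "sgn (\<beta> u) *\<^sub>R q \<in> C" using scaled pq by (auto simp: abs_sgn_eq)
        moreover have "\<forall>v\<in>C. \<forall>w\<in>C. \<bar>\<alpha> u\<bar> *\<^sub>R v + \<bar>\<beta> u\<bar> *\<^sub>R w \<in> C"
        proof (intro ballI)
          fix v w assume vw: "v \<in> C" "w \<in> C"
          show "\<bar>\<alpha> u\<bar> *\<^sub>R v + \<bar>\<beta> u\<bar> *\<^sub>R w \<in> C"
          proof (cases "\<bar>\<alpha> u\<bar> = 1")
            case True then show ?thesis using le vw by simp
          next
            case False
            then have a: "\<bar>\<alpha> u\<bar> < 1" using le by linarith
            define r where "r = \<bar>\<beta> u\<bar> / (1 - \<bar>\<alpha> u\<bar>)"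
            have r: "\<bar>r\<bar> \<le> 1" "(1 - \<bar>\<alpha> u\<bar>) * r = \<bar>\<beta> u\<bar>" using a le by (auto simp: r_def)
            have "(1 - \<bar>\<alpha> u\<bar>) *\<^sub>R (r *\<^sub>R w) + \<bar>\<alpha> u\<bar> *\<^sub>R v \<in> C"
              using convexD_alt[OF conv scaled[OF vw(2) r(1)] vw(1)] a by simp
            then show ?thesis using r(2) by (simp add: add.commute)
          qed
        qed
        ultimately show ?thesis by blast
      qed
      then show ?thesis using split[of u] by (simp add: abs_mult_sgn)
    qed
    show "\<bar>2 * (\<alpha> u + \<beta> u)\<bar> \<le> 3 \<and> \<bar>2 * (\<alpha> u - \<beta> u)\<bar> \<le> 3" if "u \<in> C" for u using sum[OF that] by (simp add: abs_le_iff abs_if split: if_splits)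
    \<comment> \<open>Both coordinates beyond 2 would make \<open>\<bar>\<alpha> u\<bar>\<close> and
      \<open>\<bar>\<beta> u\<bar>\<close> differ by more than 1.\<close>
    show "\<bar>2 * (\<alpha> u + \<beta> u)\<bar> \<le> 2 \<or> \<bar>2 * (\<alpha> u - \<beta> u)\<bar> \<le> 2" if "u \<in> C" for u
      using half_\<alpha>[OF that] half_\<beta>[OF that] half_\<alpha>[OF sym[OF that]] half_\<beta>[OF sym[OF that]]
      unfolding minus by (smt (verit))
  qed (simp_all only: coord, simp_all add: field_simps)
qed

section \<open>Families with the (4,3) property\<close>

lemma three_of_four:
  assumes "pq_property 4 3 F" "A \<in> F" "B \<in> F" "C \<in> F" "D \<in> F" "distinct [A,B,C,D]"
  shows "A \<inter> B \<inter> C \<noteq> {} \<or> A \<inter> B \<inter> D \<noteq> {} \<or> A \<inter> C \<inter> D \<noteq> {} \<or> B \<inter> C \<inter> D \<noteq> {}"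
proof -
  have c: "card {A,B,C,D} = 4" using assms(6) by simp
  have "{A,B,C,D} \<subseteq> F" using assms by simp
  then obtain H where H: "H \<subseteq> {A,B,C,D}" "card H = 3" "\<Inter>H \<noteq> {}"
    using assms(1)[unfolded pq_property_def, rule_format, OF _ c] by blast
  have "finite H" using H(2) card.infinite by fastforce
  then have "card ({A,B,C,D} - H) = 1"
    using card_Diff_subset[OF _ H(1)] c H(2) by simp
  then obtain X where X: "{A,B,C,D} - H = {X}" by (rule card_1_singletonE)
  then have XH: "X \<in> {A,B,C,D}" "{A,B,C,D} - {X} \<subseteq> H" by blast+
  obtain p where "p \<in> \<Inter>H" using H(3) by blast
  then have p: "Y = X \<or> p \<in> Y" if "Y \<in> {A,B,C,D}" for Y using that XH(2) by blast
  consider "X = A" | "X = B" | "X = C" | "X = D" using XH(1) by blast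
  then show ?thesis
  proof cases
    case 1 then have "p \<in> B \<inter> C \<inter> D" using p[of B] p[of C] p[of D] assms(6) by auto
    then show ?thesis by blast
  next
    case 2 then have "p \<in> A \<inter> C \<inter> D" using p[of A] p[of C] p[of D] assms(6) by auto
    then show ?thesis by blast
  next
    case 3 then have "p \<in> A \<inter> B \<inter> D" using p[of A] p[of B] p[of D] assms(6) by auto
    then show ?thesis by blast
  next
    case 4 then have "p \<in> A \<inter> B \<inter> C" using p[of A] p[of B] p[of C] assms(6) by auto
    then show ?thesis by blast
  qed
qed

text \<open>Of two disjoint pairs of sets with four members in all, any triple contains one of the pairs;
  so the disjoint pairs of the family form a star.\<close>

lemma almost_pairwise_intersecting:
  assumes pq: "pq_property 4 3 F" and ne: "\<And>A. A \<in> F \<Longrightarrow> A \<noteq> {}" and large: "\<not> (finite F \<and> card F < 4)"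
  obtains L where "L \<in> F" "\<And>A B. A \<in> F - {L} \<Longrightarrow> B \<in> F - {L} \<Longrightarrow> A \<inter> B \<noteq> {}"
proof -
  note star = that
  have no2: False if "A \<in> F" "B \<in> F" "C \<in> F" "D \<in> F" "distinct [A,B,C,D]" "A \<inter> B = {}" "C \<inter> D = {}" for A B C D
    using three_of_four[OF pq that(1-5)] that(6,7) by blast
  \<comment> \<open>Edges that pairwise share a vertex can also form a triangle. A fourth member
    excludes this, since every triple of the four contains two of \<open>A\<close>,
    \<open>B\<close>, \<open>C\<close>.\<close>
  have no3: False if d: "A \<in> F" "B \<in> F" "C \<in> F" "A \<inter> B = {}" "A \<inter> C = {}" "B \<inter> C = {}" for A B C
  proof -
    have "\<not> F \<subseteq> {A,B,C}"
    proof
      assume "F \<subseteq> {A,B,C}"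
      then have "finite F" "card F \<le> card {A,B,C}" by (auto intro: finite_subset card_mono)
      moreover have "card {A,B,C} \<le> 3" using card_length[of "[A,B,C]"] by simp
      ultimately show False using large by simp
    qed
    then obtain D where "D \<in> F" "D \<notin> {A,B,C}" by blast
    moreover have "A \<noteq> B" "A \<noteq> C" "B \<noteq> C" using d ne by blast+
    ultimately have "distinct [A,B,C,D]" by auto
    from three_of_four[OF pq d(1-3) \<open>D \<in> F\<close> this] show False using d(4-6) by blast
  qed
  have "F \<noteq> {}" using large by auto
  show ?thesis
  proof (cases "\<exists>A\<in>F. \<exists>B\<in>F. A \<inter> B = {}")
    case False
    obtain L where "L \<in> F" using \<open>F \<noteq> {}\<close> by blast
    then show ?thesis by (rule star) (use False in simp)
  next
    case True
    then obtain A B where AB: "A \<in> F" "B \<in> F" "A \<inter> B = {}" by blast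
    \<comment> \<open>If \<open>X\<close> is not a centre, some disjoint pair avoids
      \<open>X\<close>, and by \<open>no2\<close> it must contain \<open>Y\<close>.\<close>
    have other: "\<exists>D\<in>F - {X}. D \<noteq> Y \<and> Y \<inter> D = {}"
      if XY: "X \<in> F" "Y \<in> F" "X \<inter> Y = {}" and bad: "\<not> (\<forall>A\<in>F - {X}. \<forall>B\<in>F - {X}. A \<inter> B \<noteq> {})" for X Y
    proof -
      obtain C D where CD: "C \<in> F" "C \<noteq> X" "D \<in> F" "D \<noteq> X" "C \<inter> D = {}" using bad by auto
      have XY': "X \<noteq> Y" using XY(1,3) ne[of X] by auto
      have CD': "C \<noteq> D" using CD(1,5) ne[of C] by auto
      have "Y = C \<or> Y = D"
      proof (rule ccontr)
        assume "\<not> ?thesis"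
        then have "distinct [X,Y,C,D]" using CD(2,4) XY' CD' by simp
        then show False using no2[OF XY(1,2) CD(1,3) _ XY(3) CD(5)] by simp
      qed
      then show ?thesis
      proof
        assume "Y = C"
        then show ?thesis using CD CD' by (intro bexI[of _ D]) auto
      next
        assume "Y = D"
        then show ?thesis using CD CD' by (intro bexI[of _ C]) (auto simp: Int_commute)
      qed
    qed
    show ?thesis
    proof (rule ccontr)
      assume no: "\<not> thesis"
      have *: "\<not> (\<forall>A\<in>F - {L}. \<forall>B\<in>F - {L}. A \<inter> B \<noteq> {})" if L: "L \<in> F" for L
      proof
        assume "\<forall>A\<in>F - {L}. \<forall>B\<in>F - {L}. A \<inter> B \<noteq> {}"
        then have thesis by (intro star[OF L]) simp
        then show False using no by simp
      qed
      obtain D where D: "D \<in> F" "D \<noteq> A" "D \<noteq> B" "B \<inter> D = {}" using other[OF AB *[OF AB(1)]] by blast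
      have "B \<inter> A = {}" using AB by blast
      then obtain E where E: "E \<in> F" "E \<noteq> A" "E \<noteq> B" "A \<inter> E = {}" using other[OF AB(2,1) _ *[OF AB(2)]] by blast
      have "A \<noteq> B" using AB(1,3) ne[of A] by auto
      have "D = E"
      proof (rule ccontr)
        assume "D \<noteq> E"
        then have "distinct [A,E,B,D]" using \<open>A \<noteq> B\<close> D(2,3) E(2,3) by simp
        then show False using no2[OF AB(1) E(1) AB(2) D(1) _ E(4) D(4)] by simp
      qed
      then show False using no3[OF AB(1,2) D(1) AB(3) _ D(4)] E(4) by simp
    qed
  qed
qed

section \<open>Helly's theorem and compactness\<close>

lemma helly_plane:
  fixes Q :: "(real^2) set set"
  assumes fin: "finite Q" and conv: "\<And>W. W \<in> Q \<Longrightarrow> convex W"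
    and three: "\<And>A B C. A \<in> Q \<Longrightarrow> B \<in> Q \<Longrightarrow> C \<in> Q \<Longrightarrow> A \<inter> B \<inter> C \<noteq> {}"
  shows "\<exists>p. \<forall>W\<in>Q. p \<in> W"
proof (cases "card Q \<le> 2")
  case True
  then consider "card Q = 0" | "card Q = 1" | "card Q = 2" by linarith
  then show ?thesis
  proof cases
    case 1 then show ?thesis using fin by simp
  next
    case 2
    then obtain A where "Q = {A}" by (rule card_1_singletonE)
    then show ?thesis using three[of A A A] by auto
  next
    case 3
    then obtain A B where "Q = {A,B}" by (auto simp: card_2_iff)
    then show ?thesis using three[of A B B] by auto
  qed
next
  case False
  have "\<Inter>Q \<noteq> {}"
  proof (rule Helly)
    show "DIM(real^2) + 1 \<le> card Q" using False by simp
    show "\<forall>s\<in>Q. convex s" using conv by blast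
    fix T assume T: "T \<subseteq> Q" "card T = DIM(real^2) + 1"
    then have "card T = 3" by simp
    then obtain A B C where "T = {A,B,C}" by (metis card_3_iff)
    then show "\<Inter>T \<noteq> {}" using three[of A B C] T by auto
  qed
  then show ?thesis by blast
qed

text \<open>A piercing quadruple is a point of a compact fourth power lying in all the closed sets
  \<open>T W\<close>, so the finite intersection property applies.\<close>

lemma pierced4_compactness:
  fixes F :: "'a::heine_borel set set"
  assumes cpt: "\<And>W. W \<in> F \<Longrightarrow> compact W" and bdd: "bounded (\<Union>F)"
    and sub: "\<And>F'. F' \<subseteq> F \<Longrightarrow> finite F' \<Longrightarrow> pierced4 F'"
  shows "pierced4 F"
proof (cases "\<Union>F = {}")
  case True
  then have "F \<subseteq> {{}}" by auto
  then show ?thesis using sub[of F] finite_subset by blast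
next
  case False
  then obtain o' where o': "o' \<in> \<Union>F" by blast
  define C where "C = closure (\<Union>F)"
  have C: "compact C" "o' \<in> C" "\<And>W. W \<in> F \<Longrightarrow> W \<subseteq> C"
    using bdd o' closure_subset[of "\<Union>F"] by (auto simp: C_def compact_closure)
  define T where "T W = {(a,b,c,d). a \<in> W \<or> b \<in> W \<or> c \<in> W \<or> d \<in> W}" for W :: "'a set"
  have "(C \<times> C \<times> C \<times> C) \<inter> (\<Inter>W\<in>F. T W) \<noteq> {}"
  proof (rule compact_imp_fip_image)
    show "compact (C \<times> C \<times> C \<times> C)" using C by (intro compact_Times)
    show "closed (T W)" if "W \<in> F" for W
    proof -
      have cl: "closed W" using cpt[OF that] by (rule compact_imp_closed)
      have "T W = (fst -` W) \<union> ((\<lambda>z. fst (snd z)) -` W) \<union> ((\<lambda>z. fst (snd (snd z))) -` W) \<union> ((\<lambda>z. snd (snd (snd z))) -` W)"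
        by (auto simp: T_def)
      moreover have "closed \<dots>" by (intro closed_Un closed_vimage cl continuous_intros)
      ultimately show ?thesis by simp
    qed
    fix I' assume I: "finite I'" "I' \<subseteq> F"
    obtain a b c d where p: "\<forall>W\<in>I'. a \<in> W \<or> b \<in> W \<or> c \<in> W \<or> d \<in> W"
      using sub[OF I(2,1)] unfolding pierced4_def by (elim exE) (rule that)
    \<comment> \<open>Points outside \<open>C\<close> hit no member of \<open>F\<close>, so
      replacing them by \<open>o'\<close> loses nothing and keeps the quadruple in the compact
      set.\<close>
    define g where "g x = (if x \<in> C then x else o')" for x
    have gC: "g x \<in> C" for x using C by (simp add: g_def)
    have gW: "g x \<in> W" if "x \<in> W" "W \<in> I'" for x W
    proof -
      have "W \<subseteq> C" using that(2) I(2) C(3) by blast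
      then show ?thesis using that(1) by (auto simp: g_def)
    qed
    have "(g a, g b, g c, g d) \<in> T W" if "W \<in> I'" for W
    proof -
      have "g a \<in> W \<or> g b \<in> W \<or> g c \<in> W \<or> g d \<in> W"
        using p[rule_format, OF that] gW[OF _ that] by metis
      then show ?thesis by (simp add: T_def)
    qed
    then have "(g a, g b, g c, g d) \<in> (C \<times> C \<times> C \<times> C) \<inter> (\<Inter>W\<in>I'. T W)"
      using gC by simp
    then show "(C \<times> C \<times> C \<times> C) \<inter> (\<Inter>W\<in>I'. T W) \<noteq> {}" by blast
  qed
  then obtain a b c d where "(a,b,c,d) \<in> (\<Inter>W\<in>F. T W)" by blast
  then have "a \<in> W \<or> b \<in> W \<or> c \<in> W \<or> d \<in> W" if "W \<in> F" for W using that by (simp add: T_def)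
  then show ?thesis by (rule pierced4I)
qed

lemma pierced4_imp_piercing_number:
  assumes "pierced4 F"
  shows "piercing_number F \<le> 4"
proof -
  obtain a b c d where p: "\<forall>W\<in>F. a \<in> W \<or> b \<in> W \<or> c \<in> W \<or> d \<in> W"
    using assms unfolding pierced4_def by (elim exE) (rule that)
  have "{a,b,c,d} \<inter> W \<noteq> {}" if "W \<in> F" for W using p[rule_format, OF that] by auto
  then have "piercing_number F \<le> enat (card {a,b,c,d})"
    unfolding piercing_number_def by (intro INF_lower) simp
  also have "card {a,b,c,d} \<le> 4" using card_length[of "[a,b,c,d]"] by simp
  then have "enat (card {a,b,c,d}) \<le> 4" by (simp only: numeral_eq_enat enat_ord_simps)
  finally show ?thesis .
qed

text \<open>By symmetry and convexity the centres of two intersecting homothets differ by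
  \<open>t W + t V\<close> times a vector of \<open>C\<close>, so the separation bounds of
  \<open>box_family\<close> are those of \<open>square_coordinates\<close> scaled up.\<close>

lemma finite_almost_pairwise_pierced:
  fixes C :: "(real^2) set" and N :: "(real^2) set set"
  assumes C: "compact C" "convex C" "\<And>u. u \<in> C \<Longrightarrow> - u \<in> C" "interior C \<noteq> {}"
    and fin: "finite N"
    and hom: "\<And>W. W \<in> insert L N \<Longrightarrow> \<exists>t w. 1/2 \<le> t \<and> t \<le> 1 \<and> W = (\<lambda>x. w + t *\<^sub>R x) ` C"
    and pairwise: "\<And>A B. A \<in> N \<Longrightarrow> B \<in> N \<Longrightarrow> A \<inter> B \<noteq> {}"
    and missL: "\<And>A B D. A \<in> N \<Longrightarrow> B \<in> N \<Longrightarrow> D \<in> N \<Longrightarrow> A \<inter> L = {} \<Longrightarrow> B \<inter> L = {} \<Longrightarrow> A \<inter> B \<inter> D \<noteq> {}"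
  shows "pierced4 (insert L N)"
proof (cases "N = {}")
  case True
  obtain c where "c \<in> L"
  proof -
    have "C \<noteq> {}" using C(4) interior_subset by blast
    then show ?thesis using hom[of L] that by blast
  qed
  then show ?thesis using True by (intro pierced4I[of _ c c c c]) simp
next
  case False
  obtain f1 f2 :: "real^2 \<Rightarrow> real" and pt where lin: "linear f1" "linear f2" and pt: "\<And>x y. f1 (pt x y) = x" "\<And>x y. f2 (pt x y) = y"
    and inn: "\<And>u. \<bar>f1 u\<bar> \<le> 2 \<Longrightarrow> \<bar>f2 u\<bar> \<le> 2 \<Longrightarrow> u \<in> C"
    and out: "\<And>u. u \<in> C \<Longrightarrow> \<bar>f1 u\<bar> \<le> 3 \<and> \<bar>f2 u\<bar> \<le> 3" and dia: "\<And>u. u \<in> C \<Longrightarrow> \<bar>f1 u\<bar> \<le> 2 \<or> \<bar>f2 u\<bar> \<le> 2"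
  proof (rule square_coordinates[OF C], assumption)
    fix f1 f2 :: "real^2 \<Rightarrow> real" and pt
    assume *: "linear f1" "linear f2" "\<And>x y. f1 (pt x y) = x" "\<And>x y. f2 (pt x y) = y"
      "\<And>u. \<bar>f1 u\<bar> \<le> 2 \<Longrightarrow> \<bar>f2 u\<bar> \<le> 2 \<Longrightarrow> u \<in> C"
      "\<And>u. u \<in> C \<Longrightarrow> \<bar>f1 u\<bar> \<le> 3 \<and> \<bar>f2 u\<bar> \<le> 3" "\<And>u. u \<in> C \<Longrightarrow> \<bar>f1 u\<bar> \<le> 2 \<or> \<bar>f2 u\<bar> \<le> 2"
    show thesis by (rule that[of f1 f2 pt]) (fact *)+
  qed
  have "\<forall>W\<in>insert L N. \<exists>t w. 1/2 \<le> t \<and> t \<le> 1 \<and> W = (\<lambda>x. w + t *\<^sub>R x) ` C" using hom by blast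
  then obtain t where "\<forall>W\<in>insert L N. \<exists>w. 1/2 \<le> t W \<and> t W \<le> 1 \<and> W = (\<lambda>x. w + t W *\<^sub>R x) ` C" by metis
  then obtain w where tw: "\<forall>W\<in>insert L N. 1/2 \<le> t W \<and> t W \<le> 1 \<and> W = (\<lambda>x. w W + t W *\<^sub>R x) ` C" by metis
  have t: "1/2 \<le> t W" "t W \<le> 1" if "W \<in> insert L N" for W using tw that by blast+
  have W_eq: "W = (\<lambda>x. w W + t W *\<^sub>R x) ` C" if "W \<in> insert L N" for W using tw that by blast
  have conv: "convex W" if "W \<in> insert L N" for W
  proof -
    have "convex ((\<lambda>x. w W + t W *\<^sub>R x) ` C)" by (rule convex_affinity[OF C(2)])
    then show ?thesis using W_eq[OF that] by simp
  qed
  have diff: "\<exists>v\<in>C. w W - w V = (t W + t V) *\<^sub>R v"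
    if W: "W \<in> insert L N" and V: "V \<in> insert L N" and WV: "W \<inter> V \<noteq> {}" for W V
  proof -
    obtain z where "z \<in> W" "z \<in> V" using WV by blast
    obtain a where a: "a \<in> C" "z = w W + t W *\<^sub>R a" using W_eq[OF W] \<open>z \<in> W\<close> by auto
    obtain b where b: "b \<in> C" "z = w V + t V *\<^sub>R b" using W_eq[OF V] \<open>z \<in> V\<close> by auto
    define v where "v = (t V / (t W + t V)) *\<^sub>R b + (t W / (t W + t V)) *\<^sub>R (- a)"
    have pos: "0 < t W + t V" using t[OF W] t[OF V] by linarith
    have "v \<in> C" unfolding v_def
      using t[OF W] t[OF V] pos a b C(3) by (intro convexD[OF C(2)]) (auto simp: add_divide_distrib[symmetric])
    moreover have "(t W + t V) *\<^sub>R v = t V *\<^sub>R b - t W *\<^sub>R a"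
      using pos unfolding v_def scaleR_add_right scaleR_scaleR by simp
    moreover have "w W - w V = t V *\<^sub>R b - t W *\<^sub>R a" using a(2) b(2) by (simp add: algebra_simps)
    ultimately show ?thesis by metis
  qed
  have coord_diff: "\<exists>v\<in>C. \<bar>f1 (w W) - f1 (w V)\<bar> = (t W + t V) * \<bar>f1 v\<bar> \<and> \<bar>f2 (w W) - f2 (w V)\<bar> = (t W + t V) * \<bar>f2 v\<bar>"
    if W: "W \<in> insert L N" and V: "V \<in> insert L N" and WV: "W \<inter> V \<noteq> {}" for W V
  proof -
    obtain v where v: "v \<in> C" "w W - w V = (t W + t V) *\<^sub>R v" using diff[OF W V WV] by blast
    have "\<bar>f (w W) - f (w V)\<bar> = (t W + t V) * \<bar>f v\<bar>" if "linear f" for f :: "real^2 \<Rightarrow> real"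
    proof -
      have "f (w W) - f (w V) = (t W + t V) * f v"
        using v(2) linear_diff[OF that, of "w W" "w V"] linear_scale[OF that, of "t W + t V" v] by simp
      moreover have "0 < t W + t V" using t[OF W] t[OF V] by linarith
      ultimately show ?thesis by (simp add: abs_mult)
    qed
    then show ?thesis using v(1) lin by blast
  qed
  interpret box_family "\<lambda>W. f1 (w W)" "\<lambda>W. f2 (w W)" t pt N L
  proof
    show "finite N" "N \<noteq> {}" by (fact fin False)+
    show "1/2 \<le> t W" "t W \<le> 1" if "W \<in> insert L N" for W using t that by blast+
    show "W \<inter> V \<noteq> {}" if "W \<in> N" "V \<in> N" for W V using pairwise that by blast
    fix W assume W: "W \<in> insert L N"
    show "pt x y \<in> W" if xy: "\<bar>x - f1 (w W)\<bar> \<le> 2 * t W" "\<bar>y - f2 (w W)\<bar> \<le> 2 * t W" for x y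
    proof -
      define z where "z = (1 / t W) *\<^sub>R (pt x y - w W)"
      have tp: "0 < t W" using t[OF W] by linarith
      have "f1 z = (x - f1 (w W)) / t W" "f2 z = (y - f2 (w W)) / t W"
        by (simp_all add: z_def linear_scale[OF lin(1)] linear_scale[OF lin(2)] linear_diff[OF lin(1)] linear_diff[OF lin(2)] pt)
      then have "\<bar>f1 z\<bar> = \<bar>x - f1 (w W)\<bar> / t W" "\<bar>f2 z\<bar> = \<bar>y - f2 (w W)\<bar> / t W"
        using tp by (simp_all add: abs_divide)
      then have "\<bar>f1 z\<bar> \<le> 2" "\<bar>f2 z\<bar> \<le> 2" using xy tp by (simp_all add: pos_divide_le_eq)
      then have "z \<in> C" by (rule inn)
      moreover have "pt x y = w W + t W *\<^sub>R z" using tp by (simp add: z_def)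
      ultimately show ?thesis using W_eq[OF W] by blast
    qed
    fix V assume V: "V \<in> insert L N" and WV: "W \<inter> V \<noteq> {}"
    obtain v where v: "v \<in> C" "\<bar>f1 (w W) - f1 (w V)\<bar> = (t W + t V) * \<bar>f1 v\<bar>" "\<bar>f2 (w W) - f2 (w V)\<bar> = (t W + t V) * \<bar>f2 v\<bar>"
      using coord_diff[OF W V WV] by blast
    have tp: "0 \<le> t W + t V" using t[OF W] t[OF V] by linarith
    show "\<bar>f1 (w W) - f1 (w V)\<bar> \<le> 3 * (t W + t V)" "\<bar>f2 (w W) - f2 (w V)\<bar> \<le> 3 * (t W + t V)"
      unfolding v using out[OF v(1)] tp by (metis mult.commute mult_left_mono)+
    show "\<bar>f1 (w W) - f1 (w V)\<bar> \<le> 2 * (t W + t V) \<or> \<bar>f2 (w W) - f2 (w V)\<bar> \<le> 2 * (t W + t V)"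
      unfolding v using dia[OF v(1)] tp by (metis mult.commute mult_left_mono)
  next
    fix Q assume Q: "Q \<subseteq> N"
      and two: "\<And>W W' V. W \<in> Q \<Longrightarrow> W' \<in> Q \<Longrightarrow> V \<in> Q \<Longrightarrow> W \<inter> L \<noteq> {} \<Longrightarrow> W' \<inter> L \<noteq> {} \<Longrightarrow> W \<inter> W' \<inter> V \<noteq> {}"
    show "\<exists>p. \<forall>W\<in>Q. p \<in> W"
    proof (rule helly_plane)
      show "finite Q" using Q fin by (rule finite_subset)
      show "convex W" if "W \<in> Q" for W using conv Q that by blast
      fix A B D assume ABD: "A \<in> Q" "B \<in> Q" "D \<in> Q"
      then have N: "A \<in> N" "B \<in> N" "D \<in> N" using Q by blast+
      have comm: "A \<inter> D \<inter> B = A \<inter> B \<inter> D" "B \<inter> D \<inter> A = A \<inter> B \<inter> D" by blast+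
      consider "A \<inter> L \<noteq> {}" "B \<inter> L \<noteq> {}" | "A \<inter> L \<noteq> {}" "D \<inter> L \<noteq> {}" | "B \<inter> L \<noteq> {}" "D \<inter> L \<noteq> {}"
        | "A \<inter> L = {}" "B \<inter> L = {}" | "A \<inter> L = {}" "D \<inter> L = {}" | "B \<inter> L = {}" "D \<inter> L = {}" by argo
      then show "A \<inter> B \<inter> D \<noteq> {}"
      proof cases
        case 1 then show ?thesis using two[of A B D] ABD by simp
      next
        case 2 then show ?thesis using two[of A D B] ABD comm by simp
      next
        case 3 then show ?thesis using two[of B D A] ABD comm by simp
      next
        case 4 then show ?thesis using missL[of A B D] N by simp
      next
        case 5 then show ?thesis using missL[of A D B] N comm by simp
      next
        case 6 then show ?thesis using missL[of B D A] N comm by simp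
      qed
    qed
  qed
  show ?thesis by (rule pierced4)
qed

section \<open>Centring the body, and the passage to infinite families\<close>

lemma centered_copy:
  assumes "body B" "centrally_symmetric B"
  obtains C where "compact C" "convex C" "\<And>u. u \<in> C \<Longrightarrow> - u \<in> C" "interior C \<noteq> {}"
    "\<And>r S. homothet B r S \<Longrightarrow> \<exists>t w. r \<le> t \<and> t \<le> 1 \<and> S = (\<lambda>x. w + t *\<^sub>R x) ` C"
proof -
  obtain c where c: "(\<lambda>x. 2 *\<^sub>R c - x) ` B = B" using assms(2) by (auto simp: centrally_symmetric_def)
  define C where "C = (\<lambda>x. - c + x) ` B"
  show ?thesis
  proof (rule that[of C])
    show "compact C" "convex C" "interior C \<noteq> {}"
      using assms(1) unfolding C_def body_def interior_translation
      by (auto intro: compact_translation convex_translation simp del: add_uminus_conv_diff uminus_add_conv_diff)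
    show "- u \<in> C" if u: "u \<in> C" for u
    proof -
      obtain x where x: "x \<in> B" "u = - c + x" using u unfolding C_def by blast
      have "2 *\<^sub>R c - x \<in> (\<lambda>x. 2 *\<^sub>R c - x) ` B" using x(1) by (rule imageI)
      then have "2 *\<^sub>R c - x \<in> B" unfolding c .
      moreover have "- u = - c + (2 *\<^sub>R c - x)" using x(2) by (simp add: scaleR_2)
      ultimately show ?thesis unfolding C_def by (metis imageI)
    qed
    fix r S assume "homothet B r S"
    then obtain t v where t: "r \<le> t" "t \<le> 1" "S = (\<lambda>x. t *\<^sub>R x + v) ` B" by (auto simp: homothet_def)
    have "S = (\<lambda>x. (t *\<^sub>R c + v) + t *\<^sub>R x) ` C"
      unfolding t(3) C_def image_image by (simp add: algebra_simps)
    then show "\<exists>t w. r \<le> t \<and> t \<le> 1 \<and> S = (\<lambda>x. w + t *\<^sub>R x) ` C" using t by blast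
  qed
qed

theorem theorem1p6:
  fixes B :: "(real^2) set" and F :: "(real^2) set set"
  assumes "body B" and "centrally_symmetric B"
    and "\<And>S. S \<in> F \<Longrightarrow> homothet B (1/2) S"
    and "pq_property 4 3 F"
  shows "piercing_number F \<le> 4"
proof -
  obtain C where C: "compact C" "convex C" "\<And>u. u \<in> C \<Longrightarrow> - u \<in> C" "interior C \<noteq> {}"
    and hom: "\<And>S. S \<in> F \<Longrightarrow> \<exists>t w. 1/2 \<le> t \<and> t \<le> 1 \<and> S = (\<lambda>x. w + t *\<^sub>R x) ` C"
  proof (rule centered_copy[OF assms(1,2)])
    fix C assume C: "compact C" "convex C" "\<And>u. u \<in> C \<Longrightarrow> - u \<in> C" "interior C \<noteq> {}"
      "\<And>r S. homothet B r S \<Longrightarrow> \<exists>t w. r \<le> t \<and> t \<le> 1 \<and> S = (\<lambda>x. w + t *\<^sub>R x) ` C"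
    show thesis by (rule that[OF C(1-4)]) (use C(5)[OF assms(3)] in simp_all)
  qed
  have C_ne: "C \<noteq> {}" using C(4) interior_subset by blast
  have F_ne: "S \<noteq> {}" if "S \<in> F" for S using hom[OF that] C_ne by auto
  have F_cpt: "compact S" if "S \<in> F" for S
  proof -
    obtain t w where S: "S = (\<lambda>x. w + t *\<^sub>R x) ` C" using hom[OF \<open>S \<in> F\<close>] by blast
    then show ?thesis using compact_affinity[OF C(1), of w t] by simp
  qed
  have "pierced4 F"
  proof (cases "finite F \<and> card F < 4")
    case True
    define g where "g S = (SOME x. x \<in> S)" for S :: "(real^2) set"
    have g: "g S \<in> S" if "S \<in> F" for S unfolding g_def some_in_eq using F_ne[OF that] .
    obtain xs where xs: "set xs = F" "distinct xs" using True finite_distinct_list by blast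
    \<comment> \<open>Past the end of \<open>xs\<close> the value \<open>xs ! i\<close> is
      unspecified; such points merely fill up the four.\<close>
    let ?x = "\<lambda>i. g (xs ! i)"
    have "?x 0 \<in> S \<or> ?x 1 \<in> S \<or> ?x 2 \<in> S \<or> ?x 3 \<in> S" if S: "S \<in> F" for S
    proof -
      obtain i where i: "i < length xs" "xs ! i = S" using S unfolding xs(1)[symmetric] in_set_conv_nth by blast
      have "length xs < 4" using True distinct_card[OF xs(2)] xs(1) by simp
      then have "i = 0 \<or> i = 1 \<or> i = 2 \<or> i = 3" using i(1) by linarith
      then show ?thesis using g[OF S] i(2) by blast
    qed
    then show ?thesis by (rule pierced4I)
  next
    case False
    obtain L where L: "L \<in> F" and pw: "\<And>A B. A \<in> F - {L} \<Longrightarrow> B \<in> F - {L} \<Longrightarrow> A \<inter> B \<noteq> {}"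
    proof (rule almost_pairwise_intersecting[OF assms(4) _ False])
      show "A \<noteq> {}" if "A \<in> F" for A using F_ne[OF that] .
      fix L assume *: "L \<in> F" "\<And>A B. A \<in> F - {L} \<Longrightarrow> B \<in> F - {L} \<Longrightarrow> A \<inter> B \<noteq> {}"
      show thesis by (rule that[of L]) (fact *)+
    qed
    have missL: "A \<inter> B \<inter> D \<noteq> {}"
      if N: "A \<in> F - {L}" "B \<in> F - {L}" "D \<in> F - {L}" and d: "A \<inter> L = {}" "B \<inter> L = {}" for A B D
    proof (cases "distinct [L,A,B,D]")
      case True
      then show ?thesis using three_of_four[OF assms(4) L, of A B D] N d by blast
    next
      case False
      then consider "A = B" | "A = D" | "B = D" using N by auto
      then show ?thesis using pw N by cases (auto simp: Int_commute Int_left_commute Int_assoc)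
    qed
    \<comment> \<open>The ratios are at most 1 and all members except \<open>L\<close> meet a fixed
      one, so only \<open>L\<close> could stray, and it is itself bounded.\<close>
    have bdd: "bounded (\<Union>F)"
    proof (cases "F = {L}")
      case True then show ?thesis using F_cpt[OF L] by (simp add: compact_imp_bounded)
    next
      case F: False
      then obtain A where A: "A \<in> F - {L}" using L by blast
      obtain M where "\<forall>x\<in>C. norm x \<le> M" using compact_imp_bounded[OF C(1)] unfolding bounded_iff by blast
      then have M: "\<And>x. x \<in> C \<Longrightarrow> norm x \<le> M" by blast
      have diam: "norm (x - y) \<le> 2 * M" if W: "W \<in> F" and x: "x \<in> W" and y: "y \<in> W" for W x y
      proof -
        obtain t w where tw: "1/2 \<le> t" "t \<le> 1" "W = (\<lambda>x. w + t *\<^sub>R x) ` C" using hom[OF W] by blast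
        obtain a where a: "a \<in> C" "x = w + t *\<^sub>R a" using x tw(3) by blast
        obtain b where b: "b \<in> C" "y = w + t *\<^sub>R b" using y tw(3) by blast
        have "norm (x - y) = t * norm (a - b)" using a(2) b(2) tw by (simp add: scaleR_diff_right[symmetric])
        also have "\<dots> \<le> 1 * norm (a - b)" using tw by (intro mult_right_mono) auto
        also have "\<dots> \<le> 2 * M" using norm_triangle_ineq4[of a b] M[OF a(1)] M[OF b(1)] by simp
        finally show ?thesis .
      qed
      obtain a where a: "a \<in> A" using F_ne A by blast
      have near: "norm (x - a) \<le> 4 * M" if W: "W \<in> F - {L}" and x: "x \<in> W" for W x
      proof -
        obtain z where "z \<in> W" "z \<in> A" using pw[OF W A] by blast
        then have "norm (x - z) \<le> 2 * M" "norm (z - a) \<le> 2 * M" using diam[of W x z] diam[of A z a] W x A a by blast+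
        then show ?thesis using norm_triangle_ineq[of "x - z" "z - a"] by simp
      qed
      have "\<Union>(F - {L}) \<subseteq> cball a (4 * M)"
      proof (intro Union_least subsetI)
        fix W x assume "W \<in> F - {L}" "x \<in> W"
        then show "x \<in> cball a (4 * M)" using near[of W x] by (simp add: dist_norm norm_minus_commute)
      qed
      then have "bounded (\<Union>(F - {L}))" using bounded_cball bounded_subset by blast
      moreover have "\<Union>F = L \<union> \<Union>(F - {L})" using L by blast
      ultimately show ?thesis using F_cpt[OF L] by (simp add: compact_imp_bounded)
    qed
    show ?thesis
    proof (rule pierced4_compactness[OF _ bdd])
      show "compact S" if "S \<in> F" for S using F_cpt[OF that] .
      fix F' assume F': "F' \<subseteq> F" "finite F'"
      \<comment> \<open>\<open>L\<close> is put in whether or not it belongs to \<open>F'\<close>,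
        so that every finite subfamily is handled with the same centre.\<close>
      have "pierced4 (insert L (F' - {L}))"
      proof (rule finite_almost_pairwise_pierced[OF C])
        show "finite (F' - {L})" using F' by simp
        show "\<exists>t w. 1/2 \<le> t \<and> t \<le> 1 \<and> W = (\<lambda>x. w + t *\<^sub>R x) ` C" if "W \<in> insert L (F' - {L})" for W
          using hom that F' L by blast
        show "A \<inter> B \<noteq> {}" if "A \<in> F' - {L}" "B \<in> F' - {L}" for A B using pw that F' by blast
        show "A \<inter> B \<inter> D \<noteq> {}"
          if ABD: "A \<in> F' - {L}" "B \<in> F' - {L}" "D \<in> F' - {L}" "A \<inter> L = {}" "B \<inter> L = {}" for A B D
        proof (rule missL)
          show "A \<in> F - {L}" "B \<in> F - {L}" "D \<in> F - {L}" using ABD(1-3) F'(1) by blast+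
        qed (use ABD in auto)
      qed
      then show "pierced4 F'" by (rule pierced4_mono) auto
    qed
  qed
  then show ?thesis by (rule pierced4_imp_piercing_number)
qed

end
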